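(* Let $(X,d)$ be an Ahlfors $Q$-regular metric space with $Q>0$ and let $\delta\in(0,1)$. Then the snowflaked metric space $(X,\rho)$, $\rho:=d^\delta$, satisfies the following two conditions: (i) $(X,\rho)$ is Ahlfors $Q/\delta$-regular; (ii) there exists $\lambda\in(0,1)$ such that for all $p\in X$ and all $0<r<\operatorname{diam}_\rho(X)$ there exist $q_1,q_2\in B_\rho(p,r)$ such that $\rho(q_1,q_2)\ge\lambda r$ and $$\rho(p_1,p_2)\le\rho(p_1,q_1)+\rho(p_2,q_2)\qquad\text{for all }p_1,p_2\notin B_\rho(p,r).$$ Consequently, there exists a distance $d'$ on $X$ such that $d'\le d^\delta$, $(X,d')$ is Ahlfors $Q/\delta$-regular, and for any $A\subseteq X$ with $\mathcal{H}^{Q/\delta}_{d^\delta}(A)>0$, the distances $d'$ and $d^\delta$ are not biLipschitz equivalent on $A$.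
   Context: A distance means a metric on the set. $B_\rho(p,r)$ is the ball of radius $r$ about $p$ for $\rho$, and $\mathcal{H}^s_\rho$ is the Hausdorff $s$-measure with respect to $\rho$. A metric space $(X,\rho)$ is Ahlfors $s$-regular if there is $C\ge1$ with $\frac1C r^s\le \mathcal{H}^s_\rho(B_\rho(x,r))\le C r^s$ for all $x\in X$ and $0<r<\frac{\operatorname{diam}X}{2}$. Two distances $d',\rho$ are biLipschitz equivalent on $A$ if there is $L\ge1$ with $\frac1L\rho(p,q)\le d'(p,q)\le L\rho(p,q)$ for all $p,q\in A$.
   Formalization: The last clause is proved only for separable A; otherwise it fails, e.g. for more than continuum many copies of [0,1] at mutual distance 1, where any d' ≤ d^δ is biLipschitz to d^δ on an uncountable separated A of infinite measure. Nothing is lost if X is separable or unbounded. *)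

theory Defs
  imports "HOL-Analysis.Analysis"
begin

text \<open>
  Metric spaces are explicit pairs of a carrier \<open>X\<close> and a distance, as in the locale
  \<^locale>\<open>Metric_space\<close>, because several distances on the same set have to be compared.
\<close>

text \<open>The value is \<^term>\<open>\<infinity> :: ennreal\<close> on unbounded sets, and \<open>0\<close> on the empty set.\<close>

definition diam_wrt :: "('a \<Rightarrow> 'a \<Rightarrow> real) \<Rightarrow> 'a set \<Rightarrow> ennreal" where
  "diam_wrt \<rho> A = (SUP p\<in>A. SUP q\<in>A. ennreal (\<rho> p q))"

text \<open>
  The covering pieces have diameter at most the finite number \<open>\<epsilon>\<close>, so \<^const>\<open>enn2real\<close> loses
  nothing here. The definition is meant for exponents \<open>s > 0\<close>; for \<open>s = 0\<close> the convention
  \<open>0 powr 0 = 0\<close> would not give the counting measure.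
\<close>

definition hausdorff_premeasure ::
    "'a set \<Rightarrow> ('a \<Rightarrow> 'a \<Rightarrow> real) \<Rightarrow> real \<Rightarrow> real \<Rightarrow> 'a set \<Rightarrow> ennreal" where
  "hausdorff_premeasure X \<rho> s \<epsilon> A =
     (INF E \<in> {E :: nat \<Rightarrow> 'a set. (\<forall>i. E i \<subseteq> X \<and> diam_wrt \<rho> (E i) \<le> ennreal \<epsilon>) \<and> A \<subseteq> (\<Union>i. E i)}.
        \<Sum>i. ennreal (enn2real (diam_wrt \<rho> (E i)) powr s))"

text \<open>
  An outer measure, defined on arbitrary subsets of \<open>X\<close>, and without a normalising constant.
\<close>

definition hausdorff_measure ::
    "'a set \<Rightarrow> ('a \<Rightarrow> 'a \<Rightarrow> real) \<Rightarrow> real \<Rightarrow> 'a set \<Rightarrow> ennreal" where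
  "hausdorff_measure X \<rho> s A = (SUP \<epsilon>\<in>{0<..}. hausdorff_premeasure X \<rho> s \<epsilon> A)"

text \<open>
  Only radii below half the diameter are tested. A bounded regular space may therefore fail to be
  separable, e.g. the disjoint union of uncountably many copies of the unit interval at mutual
  distance 1. If there are more than continuum many copies, every distance below the snowflaked
  one is biLipschitz equivalent to it on some uncountable uniformly separated set, whose Hausdorff
  measure is infinite. This is why the sets on which biLipschitz equivalence is excluded have to be
  separable; that is no restriction if \<open>X\<close> is separable, in particular if \<open>X\<close> is unbounded.
\<close>

definition ahlfors_regular :: "'a set \<Rightarrow> ('a \<Rightarrow> 'a \<Rightarrow> real) \<Rightarrow> real \<Rightarrow> bool" where
  "ahlfors_regular X \<rho> s \<longleftrightarrow>
     Metric_space X \<rho> \<and>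
     (\<exists>C\<ge>1. \<forall>x\<in>X. \<forall>r>0. ennreal r < diam_wrt \<rho> X / 2 \<longrightarrow>
        ennreal (1 / C * r powr s) \<le> hausdorff_measure X \<rho> s (Metric_space.mball X \<rho> x r) \<and>
        hausdorff_measure X \<rho> s (Metric_space.mball X \<rho> x r) \<le> ennreal (C * r powr s))"

definition bilipschitz_equivalent_on ::
    "'a set \<Rightarrow> ('a \<Rightarrow> 'a \<Rightarrow> real) \<Rightarrow> ('a \<Rightarrow> 'a \<Rightarrow> real) \<Rightarrow> bool" where
  "bilipschitz_equivalent_on A d' \<rho> \<longleftrightarrow>
     (\<exists>L\<ge>1. \<forall>p\<in>A. \<forall>q\<in>A. 1 / L * \<rho> p q \<le> d' p q \<and> d' p q \<le> L * \<rho> p q)"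

definition snowflake :: "('a \<Rightarrow> 'a \<Rightarrow> real) \<Rightarrow> real \<Rightarrow> 'a \<Rightarrow> 'a \<Rightarrow> real" where
  "snowflake d \<delta> = (\<lambda>p q. d p q powr \<delta>)"

end

theory Submission imports Defs begin

text \<open>
  On a regular space \<open>X\<close>, fix rapidly decreasing scales \<open>t\<^sub>n\<close> and numbers \<open>\<epsilon>\<^sub>n \<longlonglongrightarrow> 0\<close>. Join every point
  \<open>p\<close> of a maximal \<open>8 t\<^sub>n\<close>-separated net to a point \<open>q\<close> at distance comparable to \<open>t\<^sub>n\<close>, and let \<open>d'\<close> be
  the largest distance below \<open>\<rho> = d\<^sup>\<delta>\<close> with \<open>d' p q \<le> c\<^sub>n = \<epsilon>\<^sub>n t\<^sub>n\<^sup>\<delta>\<close> for all these pairs. By duality,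
  \<open>d' x y\<close> is the supremum of \<open>\<bar>f x - f y\<bar>\<close> over the functions \<open>f\<close> that are 1-Lipschitz for \<open>\<rho>\<close> and
  vary by at most \<open>c\<^sub>n\<close> on each pair.

  A \<open>d'\<close>-ball of radius \<open>r\<close> lies in boundedly many \<open>\<rho>\<close>-balls of comparable radius. For
  \<open>c\<^sub>n \<le> r < c\<^sub>n\<^sub>-\<^sub>1\<close> this is shown by a function with values in \<open>[0, r]\<close> that is Lipschitz for \<open>d\<close> at the
  scale \<open>r\<^bsup>1/\<delta>\<^esup>\<close>. It is 1-Lipschitz for \<open>\<rho>\<close>. The pairs of coarser levels do not restrict it because of its
  range, and those of finer levels do not because a \<open>d\<close>-Lipschitz function is much flatter at small
  scales than \<open>d\<^sup>\<delta>\<close>. Only the pairs of level \<open>n\<close> require care. Regularity of \<open>d'\<close> follows by the mass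
  distribution principle.

  If \<open>d'\<close> and \<open>\<rho>\<close> are biLipschitz equivalent on \<open>A\<close>, then \<open>A\<close> has to miss a ball of radius comparable
  to \<open>t\<^sub>n\<close> at one of the two points of each pair of every sufficiently high level. So \<open>A\<close> is porous,
  hence null.
\<close>

section \<open>Hausdorff measures\<close>

lemma diam_wrt_le_iff: "diam_wrt \<rho> E \<le> c \<longleftrightarrow> (\<forall>p\<in>E. \<forall>q\<in>E. ennreal (\<rho> p q) \<le> c)"
  unfolding diam_wrt_def by (simp add: SUP_le_iff)

lemma diam_wrt_upper: "p \<in> E \<Longrightarrow> q \<in> E \<Longrightarrow> ennreal (\<rho> p q) \<le> diam_wrt \<rho> E"
  using diam_wrt_le_iff[of \<rho> E "diam_wrt \<rho> E"] by blast

lemma diam_wrt_empty [simp]: "diam_wrt \<rho> {} = 0"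
  by (simp add: diam_wrt_def bot_ennreal)

text \<open>The finite bound matters because \<open>enn2real\<close> sends an infinite diameter to
  0.\<close>

lemma le_enn2real_diam_wrt:
  assumes "p \<in> E" "q \<in> E" "diam_wrt \<rho> E \<le> ennreal e"
  shows "\<rho> p q \<le> enn2real (diam_wrt \<rho> E)"
proof -
  have fin: "diam_wrt \<rho> E < top"
    using assms(3) ennreal_less_top order_le_less_trans by blast
  have "\<rho> p q \<le> enn2real (ennreal (\<rho> p q))"
    by (cases "\<rho> p q \<ge> 0") (auto simp: ennreal_neg)
  also have "\<dots> \<le> enn2real (diam_wrt \<rho> E)"
    by (rule enn2real_mono[OF diam_wrt_upper[OF assms(1,2)] fin])
  finally show ?thesis .
qed

definition covers :: "'a set \<Rightarrow> ('a \<Rightarrow> 'a \<Rightarrow> real) \<Rightarrow> real \<Rightarrow> 'a set \<Rightarrow> (nat \<Rightarrow> 'a set) set" where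
  "covers X \<rho> \<epsilon> A = {E. (\<forall>i. E i \<subseteq> X \<and> diam_wrt \<rho> (E i) \<le> ennreal \<epsilon>) \<and> A \<subseteq> (\<Union>i. E i)}"

definition piece :: "('a \<Rightarrow> 'a \<Rightarrow> real) \<Rightarrow> real \<Rightarrow> 'a set \<Rightarrow> ennreal" where
  "piece \<rho> s E = ennreal (enn2real (diam_wrt \<rho> E) powr s)"

lemma piece_empty [simp]: "piece \<rho> s {} = 0"
  by (simp add: piece_def)

lemma premeasure_eq: "hausdorff_premeasure X \<rho> s \<epsilon> A = (INF E\<in>covers X \<rho> \<epsilon> A. \<Sum>i. piece \<rho> s (E i))"
  unfolding hausdorff_premeasure_def covers_def piece_def ..

lemma premeasure_antimono:
  assumes "\<epsilon> \<le> \<epsilon>'"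
  shows "hausdorff_premeasure X \<rho> s \<epsilon>' A \<le> hausdorff_premeasure X \<rho> s \<epsilon> A"
proof -
  have "covers X \<rho> \<epsilon> A \<subseteq> covers X \<rho> \<epsilon>' A"
    unfolding covers_def using ennreal_leI[OF assms] by (auto intro: order_trans)
  then show ?thesis unfolding premeasure_eq by (intro INF_superset_mono) auto
qed

lemma premeasure_le_measure: "\<epsilon> > 0 \<Longrightarrow> hausdorff_premeasure X \<rho> s \<epsilon> A \<le> hausdorff_measure X \<rho> s A"
  unfolding hausdorff_measure_def by (intro SUP_upper) auto

lemma hausdorff_measure_mono:
  assumes "A \<subseteq> B" shows "hausdorff_measure X \<rho> s A \<le> hausdorff_measure X \<rho> s B"
proof -
  have "covers X \<rho> \<epsilon> B \<subseteq> covers X \<rho> \<epsilon> A" for \<epsilon>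
    unfolding covers_def using assms by auto
  then show ?thesis unfolding hausdorff_measure_def premeasure_eq
    by (intro SUP_mono' INF_superset_mono) auto
qed

text \<open>Choose for each \<open>A k\<close> a cover that is optimal up to
  \<open>e / 2 ^ (k + 1)\<close> and enumerate the pieces of all covers by a single index through
  \<open>prod_decode\<close>. The errors add up to \<open>e\<close>.\<close>

lemma premeasure_countable_subadditive:
  "hausdorff_premeasure X \<rho> s \<epsilon> (\<Union>k::nat. A k) \<le> (\<Sum>k. hausdorff_premeasure X \<rho> s \<epsilon> (A k))"
proof (rule ennreal_le_epsilon)
  fix e :: real
  assume fin: "(\<Sum>k. hausdorff_premeasure X \<rho> s \<epsilon> (A k)) < top" and e: "0 < e"
  define m where "m k = hausdorff_premeasure X \<rho> s \<epsilon> (A k)" for k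
  have "\<exists>E\<in>covers X \<rho> \<epsilon> (A k). (\<Sum>i. piece \<rho> s (E i)) < m k + ennreal (e * (1/2) ^ Suc k)" for k
  proof (rule INF_approx_ennreal)
    show "0 < e * (1/2) ^ Suc k" using e by simp
    have "m k \<le> (\<Sum>k. m k)"
      using sum_le_suminf[of m "{k}"] by simp
    then show "m k \<noteq> \<infinity>" using fin unfolding m_def infinity_ennreal_def by (metis less_irrefl order_le_less_trans)
  qed (simp add: m_def premeasure_eq)
  then obtain E where E: "\<And>k. E k \<in> covers X \<rho> \<epsilon> (A k)"
      and lt: "\<And>k. (\<Sum>i. piece \<rho> s (E k i)) < m k + ennreal (e * (1/2) ^ Suc k)"
    by metis
  define F where "F i = (case prod_decode i of (k, j) \<Rightarrow> E k j)" for i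
  have "F \<in> covers X \<rho> \<epsilon> (\<Union>k. A k)"
  proof -
    have "x \<in> (\<Union>i. F i)" if xk: "x \<in> A k" for x k
    proof -
      obtain j where "x \<in> E k j" using E[of k] xk unfolding covers_def by blast
      then have "x \<in> F (prod_encode (k, j))" by (simp add: F_def)
      then show ?thesis by blast
    qed
    then show ?thesis using E by (auto simp: covers_def F_def split: prod.split)
  qed
  then have "hausdorff_premeasure X \<rho> s \<epsilon> (\<Union>k. A k) \<le> (\<Sum>i. piece \<rho> s (F i))"
    unfolding premeasure_eq by (rule INF_lower)
  also have "(\<Sum>i. piece \<rho> s (F i)) = (\<Sum>i. (\<lambda>(k, j). piece \<rho> s (E k j)) (prod_decode i))"
    by (simp add: F_def split_def)
  also have "\<dots> = (\<Sum>k. \<Sum>i. piece \<rho> s (E k i))"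
    by (rule suminf_ennreal_2dimen) simp
  also have "\<dots> \<le> (\<Sum>k. m k + ennreal (e * (1/2) ^ Suc k))"
    by (intro suminf_le less_imp_le lt) auto
  also have "\<dots> = (\<Sum>k. m k) + (\<Sum>k. ennreal (e * (1/2) ^ Suc k))"
    by (rule suminf_add[symmetric]) auto
  also have "(\<Sum>k. ennreal (e * (1/2) ^ Suc k)) = ennreal e"
    using sums_mult[OF power_half_series, of e] e by (intro suminf_ennreal_eq) auto
  finally show "hausdorff_premeasure X \<rho> s \<epsilon> (\<Union>k. A k)
      \<le> (\<Sum>k. hausdorff_premeasure X \<rho> s \<epsilon> (A k)) + ennreal e"
    by (simp add: m_def)
qed

lemma hausdorff_measure_countable_subadditive:
  "hausdorff_measure X \<rho> s (\<Union>k::nat. A k) \<le> (\<Sum>k. hausdorff_measure X \<rho> s (A k))"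
proof -
  have "hausdorff_premeasure X \<rho> s \<epsilon> (\<Union>k. A k) \<le> (\<Sum>k. hausdorff_measure X \<rho> s (A k))" if "\<epsilon> > 0" for \<epsilon>
    by (rule order_trans[OF premeasure_countable_subadditive])
       (intro suminf_le premeasure_le_measure that, auto)
  then show ?thesis unfolding hausdorff_measure_def[of _ _ _ "\<Union>k. A k"] by (intro SUP_least) auto
qed

lemma hausdorff_measure_empty [simp]: "hausdorff_measure X \<rho> s {} = 0"
proof -
  have "hausdorff_premeasure X \<rho> s \<epsilon> {} \<le> 0" for \<epsilon>
    unfolding premeasure_eq by (rule INF_lower2[of "\<lambda>_. {}"]) (auto simp: covers_def)
  then show ?thesis unfolding hausdorff_measure_def by (simp add: SUP_eq_iff)
qed

lemma hausdorff_measure_singleton: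
  assumes "x \<in> X" "\<rho> x x = 0"
  shows "hausdorff_measure X \<rho> s {x} = 0"
proof -
  have "hausdorff_premeasure X \<rho> s \<epsilon> {x} \<le> 0" if "\<epsilon> > 0" for \<epsilon>
    unfolding premeasure_eq
    by (rule INF_lower2[of "\<lambda>_. {x}"]) (use assms that in \<open>auto simp: covers_def piece_def diam_wrt_def\<close>)
  then have "hausdorff_measure X \<rho> s {x} \<le> 0"
    unfolding hausdorff_measure_def by (intro SUP_least) auto
  then show ?thesis by simp
qed

lemma hausdorff_measure_finite_UN_le:
  assumes "finite I"
  shows "hausdorff_measure X \<rho> s (\<Union>i\<in>I. A i) \<le> (\<Sum>i\<in>I. hausdorff_measure X \<rho> s (A i))"
  using assms
proof (induction I)
  case (insert i I)
  let ?B = "\<lambda>k::nat. if k = 0 then A i else if k = 1 then (\<Union>i\<in>I. A i) else {}"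
  have "(\<Union>i\<in>insert i I. A i) \<subseteq> (\<Union>k. ?B k)"
  proof
    fix x assume "x \<in> (\<Union>i\<in>insert i I. A i)"
    then have "x \<in> ?B 0 \<or> x \<in> ?B 1" by auto
    then show "x \<in> (\<Union>k. ?B k)" by blast
  qed
  then have "hausdorff_measure X \<rho> s (\<Union>i\<in>insert i I. A i) \<le> hausdorff_measure X \<rho> s (\<Union>k. ?B k)"
    by (rule hausdorff_measure_mono)
  also have "\<dots> \<le> (\<Sum>k. hausdorff_measure X \<rho> s (?B k))"
    by (rule hausdorff_measure_countable_subadditive)
  also have "\<dots> = (\<Sum>k\<in>{0,1}. hausdorff_measure X \<rho> s (?B k))"
    by (rule suminf_finite) auto
  also have "\<dots> = hausdorff_measure X \<rho> s (A i) + hausdorff_measure X \<rho> s (\<Union>i\<in>I. A i)"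
    by simp
  finally show ?case using insert by (simp add: add_left_mono order_trans)
qed simp

text \<open>A piece of diameter less than \<open>\<eta>\<close> cannot meet both sets, so a fine
  cover of the union splits into a cover of each. This additivity across gaps stands in for
  measurability.\<close>

lemma hausdorff_measure_separated_superadditive:
  assumes "\<eta> > 0" and sep: "\<And>a b. a \<in> A \<Longrightarrow> b \<in> B \<Longrightarrow> \<eta> \<le> \<rho> a b"
  shows "hausdorff_measure X \<rho> s A + hausdorff_measure X \<rho> s B \<le> hausdorff_measure X \<rho> s (A \<union> B)"
proof -
  let ?h = "\<lambda>\<epsilon> A. hausdorff_premeasure X \<rho> s \<epsilon> A"
  have pre: "?h \<epsilon> A + ?h \<epsilon> B \<le> ?h \<epsilon> (A \<union> B)" if "\<epsilon> < \<eta>" for \<epsilon>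
    unfolding premeasure_eq[of _ _ _ _ "A \<union> B"]
  proof (rule INF_greatest)
    fix E assume E: "E \<in> covers X \<rho> \<epsilon> (A \<union> B)"
    \<comment> \<open>Irrelevant pieces are replaced by the empty set, which contributes 0 and keeps
      the index set.\<close>
    define EA where "EA i = (if E i \<inter> A = {} then {} else E i)" for i
    define EB where "EB i = (if E i \<inter> B = {} then {} else E i)" for i
    have disj: "E i \<inter> A = {} \<or> E i \<inter> B = {}" for i
    proof (rule ccontr)
      assume "\<not> ?thesis"
      then obtain a b where ab: "a \<in> E i" "a \<in> A" "b \<in> E i" "b \<in> B" by blast
      have "ennreal (\<rho> a b) \<le> ennreal \<epsilon>"
        using E ab diam_wrt_le_iff unfolding covers_def by fast
      then have "\<rho> a b \<le> \<epsilon> \<or> \<rho> a b \<le> 0" by (metis ennreal_le_iff2)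
      with sep[OF ab(2,4)] that \<open>\<eta> > 0\<close> show False by linarith
    qed
    have EA: "EA \<in> covers X \<rho> \<epsilon> A" and EB: "EB \<in> covers X \<rho> \<epsilon> B"
      using E unfolding covers_def EA_def EB_def by (auto split: if_splits) blast+
    have "?h \<epsilon> A + ?h \<epsilon> B \<le> (\<Sum>i. piece \<rho> s (EA i)) + (\<Sum>i. piece \<rho> s (EB i))"
      unfolding premeasure_eq by (intro add_mono INF_lower EA EB)
    also have "\<dots> = (\<Sum>i. piece \<rho> s (EA i) + piece \<rho> s (EB i))"
      by (rule suminf_add) auto
    also have "\<dots> \<le> (\<Sum>i. piece \<rho> s (E i))"
    proof (rule suminf_le)
      show "piece \<rho> s (EA i) + piece \<rho> s (EB i) \<le> piece \<rho> s (E i)" for i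
        using disj[of i] by (auto simp: EA_def EB_def)
    qed auto
    finally show "?h \<epsilon> A + ?h \<epsilon> B \<le> (\<Sum>i. piece \<rho> s (E i))" .
  qed
  \<comment> \<open>Premeasures increase as the scale shrinks, so the family is directed and the
    supremum of the sums is the sum of the suprema.\<close>
  have dir: "?h \<epsilon> A + ?h \<epsilon>' B \<le> ?h (min (min \<epsilon> \<epsilon>') (\<eta>/2)) A + ?h (min (min \<epsilon> \<epsilon>') (\<eta>/2)) B" for \<epsilon> \<epsilon>'
    by (intro add_mono premeasure_antimono) auto
  have "hausdorff_measure X \<rho> s A + hausdorff_measure X \<rho> s B = (SUP \<epsilon>\<in>{0<..}. ?h \<epsilon> A + ?h \<epsilon> B)"
    unfolding hausdorff_measure_def
  proof (rule SUP_add_directed_ennreal[symmetric])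
    fix \<epsilon> \<epsilon>' :: real assume "\<epsilon> \<in> {0<..}" "\<epsilon>' \<in> {0<..}"
    then show "\<exists>k\<in>{0<..}. ?h \<epsilon> A + ?h \<epsilon>' B \<le> ?h k A + ?h k B"
      using dir[of \<epsilon> \<epsilon>'] \<open>\<eta> > 0\<close> by (intro bexI[of _ "min (min \<epsilon> \<epsilon>') (\<eta>/2)"]) auto
  qed
  also have "\<dots> \<le> hausdorff_measure X \<rho> s (A \<union> B)"
  proof (rule SUP_least)
    fix \<epsilon> :: real assume "\<epsilon> \<in> {0<..}"
    then have pos: "0 < min \<epsilon> (\<eta>/2)" using \<open>\<eta> > 0\<close> by simp
    have "?h \<epsilon> A + ?h \<epsilon> B \<le> ?h (min \<epsilon> (\<eta>/2)) A + ?h (min \<epsilon> (\<eta>/2)) B"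
      by (intro add_mono premeasure_antimono) auto
    also have "\<dots> \<le> ?h (min \<epsilon> (\<eta>/2)) (A \<union> B)"
      by (rule pre) (use \<open>\<eta> > 0\<close> in \<open>simp add: min_def\<close>)
    also have "\<dots> \<le> hausdorff_measure X \<rho> s (A \<union> B)"
      by (rule premeasure_le_measure[OF pos])
    finally show "?h \<epsilon> A + ?h \<epsilon> B \<le> hausdorff_measure X \<rho> s (A \<union> B)" .
  qed
  finally show ?thesis .
qed

lemma hausdorff_measure_separated_sum_le:
  assumes "finite I" "\<eta> > 0"
    and sep: "\<And>i j a b. i \<in> I \<Longrightarrow> j \<in> I \<Longrightarrow> i \<noteq> j \<Longrightarrow> a \<in> A i \<Longrightarrow> b \<in> A j \<Longrightarrow> \<eta> \<le> \<rho> a b"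
  shows "(\<Sum>i\<in>I. hausdorff_measure X \<rho> s (A i)) \<le> hausdorff_measure X \<rho> s (\<Union>i\<in>I. A i)"
  using assms(1) sep
proof (induction I)
  case (insert i I)
  have "(\<Sum>i\<in>insert i I. hausdorff_measure X \<rho> s (A i))
      = hausdorff_measure X \<rho> s (A i) + (\<Sum>i\<in>I. hausdorff_measure X \<rho> s (A i))"
    using insert by simp
  also have "\<dots> \<le> hausdorff_measure X \<rho> s (A i) + hausdorff_measure X \<rho> s (\<Union>i\<in>I. A i)"
    by (intro add_left_mono insert.IH insert.prems) auto
  also have "\<dots> \<le> hausdorff_measure X \<rho> s (A i \<union> (\<Union>i\<in>I. A i))"
  proof (rule hausdorff_measure_separated_superadditive[OF \<open>\<eta> > 0\<close>])
    fix a b assume "a \<in> A i" "b \<in> (\<Union>i\<in>I. A i)"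
    then show "\<eta> \<le> \<rho> a b" using insert.prems[of i] insert.hyps by blast
  qed
  finally show ?case by simp
qed simp

lemma hausdorff_measure_mono_dist:
  assumes le: "\<And>p q. p \<in> X \<Longrightarrow> q \<in> X \<Longrightarrow> d' p q \<le> \<rho> p q" and "s \<ge> 0"
  shows "hausdorff_measure X d' s A \<le> hausdorff_measure X \<rho> s A"
proof -
  have diam: "diam_wrt d' E \<le> diam_wrt \<rho> E" if "E \<subseteq> X" for E
    unfolding diam_wrt_le_iff using that
    by (meson diam_wrt_upper ennreal_leI le order_trans subsetD)
  have "hausdorff_premeasure X d' s \<epsilon> A \<le> hausdorff_premeasure X \<rho> s \<epsilon> A" for \<epsilon>
    unfolding premeasure_eq
  proof (rule INF_mono)
    fix E assume E: "E \<in> covers X \<rho> \<epsilon> A"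
    have "E \<in> covers X d' \<epsilon> A"
      using E diam unfolding covers_def by (blast intro: order_trans)
    moreover have "(\<Sum>i. piece d' s (E i)) \<le> (\<Sum>i. piece \<rho> s (E i))"
    proof (rule suminf_le)
      fix i
      have "diam_wrt \<rho> (E i) < top" "E i \<subseteq> X"
        using E unfolding covers_def by (auto intro: order_le_less_trans)
      then have "enn2real (diam_wrt d' (E i)) \<le> enn2real (diam_wrt \<rho> (E i))"
        by (intro enn2real_mono diam)
      then show "piece d' s (E i) \<le> piece \<rho> s (E i)"
        unfolding piece_def using \<open>s \<ge> 0\<close> by (intro ennreal_leI powr_mono2) auto
    qed auto
    ultimately show "\<exists>F\<in>covers X d' \<epsilon> A. (\<Sum>i. piece d' s (F i)) \<le> (\<Sum>i. piece \<rho> s (E i))" by blast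
  qed
  then show ?thesis unfolding hausdorff_measure_def by (intro SUP_mono') auto
qed

text \<open>The mass distribution principle, with the Hausdorff measure of another distance
  \<open>\<rho>\<close> as mass. A piece of \<open>d'\<close>-diameter \<open>D > 0\<close> lies in
  a \<open>d'\<close>-ball of radius \<open>2 * D\<close>, so its mass is at most a constant times
  \<open>D powr s\<close>; summing over a cover gives the bound.\<close>

lemma hausdorff_measure_mass_distribution:
  assumes d': "Metric_space X d'" and zero: "\<And>x. x \<in> X \<Longrightarrow> \<rho> x x = 0" and "M > 0" "r0 > 0"
    and ball: "\<And>x r. x \<in> X \<Longrightarrow> 0 < r \<Longrightarrow> r < r0 \<Longrightarrow>
      hausdorff_measure X \<rho> t (Metric_space.mball X d' x r) \<le> ennreal (M * r powr s)"
  shows "ennreal (1 / (M * 2 powr s)) * hausdorff_measure X \<rho> t A \<le> hausdorff_measure X d' s A"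
proof -
  interpret d': Metric_space X d' by fact
  let ?\<mu> = "hausdorff_measure X \<rho> t"
  let ?K = "ennreal (M * 2 powr s)"
  \<comment> \<open>Makes the doubled diameter at most \<open>r0 / 2\<close>, a radius to which
    \<open>ball\<close> applies.\<close>
  let ?\<epsilon> = "r0 / 4"
  have piece_le: "?\<mu> E \<le> ?K * piece d' s E" if EX: "E \<subseteq> X" and dE: "diam_wrt d' E \<le> ennreal ?\<epsilon>" for E
  proof (cases "E = {}")
    case False
    then obtain x where x: "x \<in> E" by blast
    define D where "D = enn2real (diam_wrt d' E)"
    have D: "d' x y \<le> D" if "y \<in> E" for y
      unfolding D_def by (rule le_enn2real_diam_wrt[OF x that dE])
    have D0: "0 \<le> D" "D \<le> ?\<epsilon>" unfolding D_def
      using enn2real_leI[OF _ dE] \<open>r0 > 0\<close> by auto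
    show ?thesis
    proof (cases "D = 0")
      case True
      have "E \<subseteq> {x}"
      proof
        fix y assume y: "y \<in> E"
        then have "d' x y = 0" using D[of y] True d'.nonneg[of x y] by linarith
        then show "y \<in> {x}" using d'.zero[of x y] EX x y by auto
      qed
      then have "?\<mu> E \<le> ?\<mu> {x}" by (rule hausdorff_measure_mono)
      then show ?thesis using hausdorff_measure_singleton[of x X \<rho> t] zero[of x] EX x by auto
    next
      case False
      \<comment> \<open>Balls are open; the doubling makes \<open>d' x y \<le> D\<close>
        strict.\<close>
      have "E \<subseteq> d'.mball x (2 * D)"
        using EX x D False D0 by (fastforce simp: subset_iff)
      then have "?\<mu> E \<le> ?\<mu> (d'.mball x (2 * D))" by (rule hausdorff_measure_mono)
      also have "\<dots> \<le> ennreal (M * (2 * D) powr s)"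
        using EX x D0 False \<open>r0 > 0\<close> by (intro ball) auto
      also have "M * (2 * D) powr s = (M * 2 powr s) * D powr s"
        using D0 by (simp add: powr_mult)
      also have "ennreal \<dots> = ?K * piece d' s E"
        unfolding piece_def D_def[symmetric] using \<open>M > 0\<close> by (intro ennreal_mult) auto
      finally show ?thesis .
    qed
  qed simp
  let ?k = "ennreal (1 / (M * 2 powr s))"
  have kK: "?k * ?K = 1"
    using \<open>M > 0\<close> by (simp add: ennreal_mult[symmetric])
  have "?k * ?\<mu> A \<le> hausdorff_premeasure X d' s ?\<epsilon> A"
    unfolding premeasure_eq
  proof (rule INF_greatest)
    fix E assume E: "E \<in> covers X d' ?\<epsilon> A"
    then have "?\<mu> A \<le> ?\<mu> (\<Union>i. E i)" by (intro hausdorff_measure_mono) (auto simp: covers_def)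
    also have "\<dots> \<le> (\<Sum>i. ?\<mu> (E i))" by (rule hausdorff_measure_countable_subadditive)
    also have "\<dots> \<le> (\<Sum>i. ?K * piece d' s (E i))"
      by (intro suminf_le piece_le) (use E in \<open>auto simp: covers_def\<close>)
    also have "\<dots> = ?K * (\<Sum>i. piece d' s (E i))" by simp
    finally have "?k * ?\<mu> A \<le> ?k * (?K * (\<Sum>i. piece d' s (E i)))" by (intro mult_left_mono) auto
    then show "?k * ?\<mu> A \<le> (\<Sum>i. piece d' s (E i))"
      by (simp add: mult.assoc[symmetric] kK)
  qed
  also have "\<dots> \<le> hausdorff_measure X d' s A"
    by (intro premeasure_le_measure) (use \<open>r0 > 0\<close> in auto)
  finally show ?thesis .
qed

section \<open>Snowflakes\<close>

text \<open>Strict concavity in quantitative form. After scaling to \<open>M + m = 1\<close> the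
  smaller share \<open>u\<close> is at most 1/2, hence \<open>u powr \<delta>\<close> is at least
  \<open>2 powr (1 - \<delta>) * u\<close>. This surplus over plain subadditivity is what the ball
  condition relies on.\<close>

lemma add_powr_strict_bound:
  fixes \<delta> m M :: real
  assumes \<delta>: "0 < \<delta>" "\<delta> < 1" and m: "0 < m" "m \<le> M"
  shows "(M + 2 powr (1 - \<delta>) * m) powr \<delta> \<le> M powr \<delta> + m powr \<delta>"
proof -
  define \<kappa> where "\<kappa> = (2::real) powr (1 - \<delta>)"
  define S where "S = M + m"
  define u where "u = m / S"
  have S: "S > 0" using m by (simp add: S_def)
  have u: "0 < u" "u \<le> 1/2" using m S by (auto simp: u_def S_def field_simps)
  have Su: "m = S * u" "M = S * (1 - u)" using S by (simp_all add: u_def S_def field_simps)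
  have \<kappa>: "\<kappa> \<ge> 1" using \<delta> unfolding \<kappa>_def by (intro ge_one_powr_ge_zero) auto
  have "S * (1 + u * (\<kappa> - 1)) = S + (S * u) * (\<kappa> - 1)" by (simp add: algebra_simps)
  also have "\<dots> = M + \<kappa> * m" unfolding Su(1)[symmetric] by (simp add: S_def algebra_simps)
  finally have "(M + \<kappa> * m) powr \<delta> = S powr \<delta> * (1 + u * (\<kappa> - 1)) powr \<delta>"
    by (metis powr_mult)
  also have "(1 + u * (\<kappa> - 1)) powr \<delta> \<le> (1 + u * (\<kappa> - 1)) powr 1"
    using u \<kappa> \<delta> by (intro powr_mono) auto
  also have "\<dots> = (1 - u) + u * \<kappa>"
    using mult_nonneg_nonneg[of u "\<kappa> - 1"] u \<kappa> by (subst powr_one) (auto simp: right_diff_distrib)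
  also have "\<dots> \<le> (1 - u) powr \<delta> + u powr \<delta>"
  proof (rule add_mono)
    show "1 - u \<le> (1 - u) powr \<delta>"
      using powr_mono'[of \<delta> 1 "1 - u"] u \<delta> by simp
    have "\<kappa> = (1/2) powr (\<delta> - 1)"
      by (simp add: \<kappa>_def powr_divide powr_minus_divide[symmetric])
    also have "\<dots> \<le> u powr (\<delta> - 1)"
      using u \<delta> by (intro powr_mono2') auto
    finally have "u * \<kappa> \<le> u * u powr (\<delta> - 1)" using u by simp
    also have "\<dots> = u powr \<delta>" using u powr_add[of u 1 "\<delta> - 1"] by simp
    finally show "u * \<kappa> \<le> u powr \<delta>" .
  qed
  finally have "(M + \<kappa> * m) powr \<delta> \<le> S powr \<delta> * ((1 - u) powr \<delta> + u powr \<delta>)"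
    by (simp add: mult_left_mono)
  also have "\<dots> = M powr \<delta> + m powr \<delta>"
    unfolding Su(2) by (subst Su(1)) (simp add: powr_mult distrib_left)
  finally show ?thesis by (simp add: \<kappa>_def)
qed

lemma powr_subadditive:
  fixes \<delta> a b :: real
  assumes \<delta>: "0 < \<delta>" "\<delta> < 1" and ab: "0 \<le> a" "0 \<le> b"
  shows "(a + b) powr \<delta> \<le> a powr \<delta> + b powr \<delta>"
proof -
  have *: "(M + m) powr \<delta> \<le> M powr \<delta> + m powr \<delta>" if "0 < m" "m \<le> M" for m M :: real
  proof -
    have "m \<le> 2 powr (1 - \<delta>) * m" using that \<delta> by (simp add: ge_one_powr_ge_zero)
    then have "(M + m) powr \<delta> \<le> (M + 2 powr (1 - \<delta>) * m) powr \<delta>"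
      using that \<delta> by (intro powr_mono2) auto
    with add_powr_strict_bound[OF \<delta> that] show ?thesis by linarith
  qed
  show ?thesis
    using *[of a b] *[of b a] ab by (cases "a = 0 \<or> b = 0") (force simp: add.commute)+
qed

lemma Metric_space_snowflake:
  assumes "Metric_space X d" "0 < \<delta>" "\<delta> < 1"
  shows "Metric_space X (snowflake d \<delta>)"
proof -
  interpret Metric_space X d by fact
  show ?thesis
  proof
    fix x y z assume "x \<in> X" "y \<in> X" "z \<in> X"
    then have "d x z powr \<delta> \<le> (d x y + d y z) powr \<delta>"
      using assms by (intro powr_mono2 triangle) auto
    also have "\<dots> \<le> d x y powr \<delta> + d y z powr \<delta>"
      using assms by (intro powr_subadditive) auto
    finally show "snowflake d \<delta> x z \<le> snowflake d \<delta> x y + snowflake d \<delta> y z"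
      by (simp add: snowflake_def)
  qed (auto simp: snowflake_def commute)
qed

lemma powr_less_powr_inverse_iff:
  fixes a r \<delta> :: real
  assumes "0 < \<delta>" "0 \<le> a" "0 \<le> r"
  shows "a powr \<delta> < r \<longleftrightarrow> a < r powr (1 / \<delta>)"
proof -
  have "a < r powr (1 / \<delta>) \<longleftrightarrow> a powr \<delta> < (r powr (1 / \<delta>)) powr \<delta>"
    using assms by (smt (verit) powr_less_mono2 powr_ge_zero powr_mono2)
  then show ?thesis using assms by (simp add: powr_powr)
qed

lemma powr_le_powr_inverse_iff:
  fixes a r \<delta> :: real
  assumes "0 < \<delta>" "0 \<le> a" "0 \<le> r"
  shows "a powr \<delta> \<le> r \<longleftrightarrow> a \<le> r powr (1 / \<delta>)"
proof -
  have "a \<le> r powr (1 / \<delta>) \<longleftrightarrow> a powr \<delta> \<le> (r powr (1 / \<delta>)) powr \<delta>"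
    using assms by (smt (verit) powr_less_mono2 powr_ge_zero powr_mono2)
  then show ?thesis using assms by (simp add: powr_powr)
qed

lemma mball_snowflake:
  assumes "Metric_space X d" "0 < \<delta>" "\<delta> < 1" "0 \<le> r"
  shows "Metric_space.mball X (snowflake d \<delta>) x r = Metric_space.mball X d x (r powr (1 / \<delta>))"
proof -
  interpret Metric_space X d by fact
  interpret \<rho>: Metric_space X "snowflake d \<delta>" by (rule Metric_space_snowflake[OF assms(1-3)])
  show ?thesis
    using powr_less_powr_inverse_iff[OF assms(2) nonneg assms(4)]
    by (simp add: set_eq_iff, simp add: snowflake_def)
qed

lemma diam_snowflake_le_iff:
  assumes "Metric_space X d" "0 < \<delta>" "0 \<le> r"
  shows "diam_wrt (snowflake d \<delta>) E \<le> ennreal r \<longleftrightarrow> diam_wrt d E \<le> ennreal (r powr (1 / \<delta>))"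
proof -
  interpret Metric_space X d by fact
  show ?thesis
    using powr_le_powr_inverse_iff[OF assms(2) nonneg assms(3)] assms(3)
    by (auto simp: diam_wrt_le_iff snowflake_def ennreal_le_iff)
qed

text \<open>Diameters are raised to the power \<delta>, which cancels against the exponent
  \<open>s / \<delta>\<close>. The covers at scale \<epsilon> are those for \<open>d\<close> at
  scale \<open>\<epsilon> powr (1 / \<delta>)\<close>, and this substitution permutes the positive
  scales, so no constant is lost.\<close>

lemma hausdorff_measure_snowflake:
  assumes d: "Metric_space X d" and \<delta>: "0 < \<delta>"
  shows "hausdorff_measure X (snowflake d \<delta>) (s / \<delta>) A = hausdorff_measure X d s A"
proof -
  have piece: "piece (snowflake d \<delta>) (s / \<delta>) E = piece d s E"
    if fin: "diam_wrt d E \<le> ennreal e" for E e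
  proof -
    define a where "a = enn2real (diam_wrt d E)"
    define b where "b = enn2real (diam_wrt (snowflake d \<delta>) E)"
    have a: "diam_wrt d E = ennreal a"
      unfolding a_def using fin by (metis ennreal_enn2real ennreal_less_top order_le_less_trans)
    have a0: "a \<ge> 0" and b0: "b \<ge> 0" by (simp_all add: a_def b_def)
    have le: "diam_wrt (snowflake d \<delta>) E \<le> ennreal (a powr \<delta>)"
      using diam_snowflake_le_iff[OF d \<delta>, of "a powr \<delta>" E] a a0 \<delta> by (simp add: powr_powr)
    then have b: "diam_wrt (snowflake d \<delta>) E = ennreal b"
      unfolding b_def by (metis ennreal_enn2real ennreal_less_top order_le_less_trans)
    have "b \<le> a powr \<delta>" using le b by simp
    moreover have "a \<le> b powr (1 / \<delta>)"
      using diam_snowflake_le_iff[OF d \<delta>, of b E] a b b0 by simp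
    then have "a powr \<delta> \<le> b"
      using powr_le_powr_inverse_iff[OF \<delta> a0 b0] by simp
    ultimately have "b = a powr \<delta>" by simp
    then show ?thesis
      unfolding piece_def a_def[symmetric] b_def[symmetric] using \<delta> by (simp add: powr_powr)
  qed
  have pre: "hausdorff_premeasure X (snowflake d \<delta>) (s / \<delta>) \<epsilon> A
      = hausdorff_premeasure X d s (\<epsilon> powr (1 / \<delta>)) A" if "\<epsilon> > 0" for \<epsilon>
  proof -
    have "covers X (snowflake d \<delta>) \<epsilon> A = covers X d (\<epsilon> powr (1 / \<delta>)) A"
      unfolding covers_def using that diam_snowflake_le_iff[OF d \<delta>] by simp
    then show ?thesis
      unfolding premeasure_eq
      by (intro INF_cong suminf_cong piece[of _ "\<epsilon> powr (1 / \<delta>)"]) (auto simp: covers_def)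
  qed
  have "(\<lambda>\<epsilon>::real. \<epsilon> powr (1 / \<delta>)) ` {0<..} = {0<..}"
  proof (intro equalityI subsetI)
    fix x :: real assume "x \<in> {0<..}"
    then show "x \<in> (\<lambda>\<epsilon>. \<epsilon> powr (1 / \<delta>)) ` {0<..}"
      using \<delta> by (intro image_eqI[of _ _ "x powr \<delta>"]) (auto simp: powr_powr)
  qed auto
  then have "hausdorff_measure X d s A
      = (SUP \<epsilon>\<in>(\<lambda>\<epsilon>::real. \<epsilon> powr (1 / \<delta>)) ` {0<..}. hausdorff_premeasure X d s \<epsilon> A)"
    by (simp add: hausdorff_measure_def)
  also have "\<dots> = hausdorff_measure X (snowflake d \<delta>) (s / \<delta>) A"
    unfolding hausdorff_measure_def image_image by (intro SUP_cong) (auto simp: pre)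
  finally show ?thesis ..
qed

lemma less_half_ennreal_iff:
  assumes "0 \<le> r" shows "ennreal r < a / 2 \<longleftrightarrow> ennreal (2 * r) < a"
proof (cases a)
  case (real x)
  have "ennreal x / 2 = ennreal (x / 2)" using real divide_ennreal[of x 2] by simp
  then show ?thesis using real assms by (auto simp: ennreal_less_iff)
qed (simp add: ennreal_top_divide)

lemma less_diam_snowflake_iff:
  assumes "Metric_space X d" "0 < \<delta>" "0 \<le> r"
  shows "ennreal r < diam_wrt (snowflake d \<delta>) E \<longleftrightarrow> ennreal (r powr (1 / \<delta>)) < diam_wrt d E"
  using diam_snowflake_le_iff[OF assms] by (meson not_le)

lemma ahlfors_regular_snowflake:
  assumes reg: "ahlfors_regular X d Q" and \<delta>: "0 < \<delta>" "\<delta> < 1"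
  shows "ahlfors_regular X (snowflake d \<delta>) (Q / \<delta>)"
proof -
  have d: "Metric_space X d" using reg by (simp add: ahlfors_regular_def)
  obtain C where C: "C \<ge> 1" and ball: "\<And>x r. x \<in> X \<Longrightarrow> r > 0 \<Longrightarrow> ennreal r < diam_wrt d X / 2 \<Longrightarrow>
        ennreal (1 / C * r powr Q) \<le> hausdorff_measure X d Q (Metric_space.mball X d x r) \<and>
        hausdorff_measure X d Q (Metric_space.mball X d x r) \<le> ennreal (C * r powr Q)"
    using reg unfolding ahlfors_regular_def by blast
  show ?thesis
    unfolding ahlfors_regular_def
  proof (intro conjI Metric_space_snowflake[OF d \<delta>] exI[of _ C] C ballI allI impI)
    fix x r assume x: "x \<in> X" and r: "r > 0" and lt: "ennreal r < diam_wrt (snowflake d \<delta>) X / 2"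
    define T where "T = r powr (1 / \<delta>)"
    have T: "T > 0" "T powr Q = r powr (Q / \<delta>)" using r \<delta> by (simp_all add: T_def powr_powr)
    have "ennreal ((2 * r) powr (1 / \<delta>)) < diam_wrt d X"
      using lt less_half_ennreal_iff[of r] less_diam_snowflake_iff[OF d \<delta>(1), of "2 * r"] r by simp
    \<comment> \<open>Since \<open>1 / \<delta> \<ge> 1\<close>, a radius below half the snowflaked
      diameter corresponds to one below half the diameter for \<open>d\<close>.\<close>
    moreover have "2 * T \<le> (2 * r) powr (1 / \<delta>)"
      using powr_mono[of 1 "1 / \<delta>" "2::real"] r \<delta> by (simp add: T_def powr_mult)
    ultimately have "ennreal (2 * T) < diam_wrt d X" by (meson ennreal_leI order_le_less_trans)
    then have "ennreal T < diam_wrt d X / 2" using less_half_ennreal_iff T by simp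
    from ball[OF x T(1) this] show
      "ennreal (1 / C * r powr (Q / \<delta>))
         \<le> hausdorff_measure X (snowflake d \<delta>) (Q / \<delta>) (Metric_space.mball X (snowflake d \<delta>) x r)"
      "hausdorff_measure X (snowflake d \<delta>) (Q / \<delta>) (Metric_space.mball X (snowflake d \<delta>) x r)
         \<le> ennreal (C * r powr (Q / \<delta>))"
      using r by (simp_all add: hausdorff_measure_snowflake[OF d \<delta>(1)] mball_snowflake[OF d \<delta>] T T_def[symmetric])
  qed
qed

section \<open>Regular spaces and porous sets\<close>

context Metric_space
begin

definition separated :: "real \<Rightarrow> 'a set \<Rightarrow> bool" where
  "separated e N \<longleftrightarrow> (\<forall>p\<in>N. \<forall>q\<in>N. p \<noteq> q \<longrightarrow> e \<le> d p q)"

text \<open>Zorn's lemma: a point at distance at least \<open>e\<close> from all of a maximal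
  separated set could be added to it.\<close>

lemma ex_maximal_separated:
  assumes "A \<subseteq> M" "e > 0"
  obtains N where "N \<subseteq> A" "separated e N" "\<And>a. a \<in> A \<Longrightarrow> \<exists>p\<in>N. d p a < e"
proof -
  define F where "F = {N. N \<subseteq> A \<and> separated e N}"
  have "\<exists>N\<in>F. \<forall>N'\<in>F. N \<subseteq> N' \<longrightarrow> N' = N"
  proof (rule subset_Zorn)
    fix c assume "subset.chain F c"
    then have c: "c \<subseteq> F" and chain: "\<And>N N'. N \<in> c \<Longrightarrow> N' \<in> c \<Longrightarrow> N \<subseteq> N' \<or> N' \<subseteq> N"
      unfolding subset_chain_def by auto
    have "separated e (\<Union>c)"
      unfolding separated_def
    proof (intro ballI impI)
      fix p q assume "p \<in> \<Union>c" "q \<in> \<Union>c" "p \<noteq> q"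
      then obtain N N' where N: "N \<in> c" "N' \<in> c" "p \<in> N" "q \<in> N'" by blast
      then consider "p \<in> N'" | "q \<in> N" using chain by blast
      then show "e \<le> d p q"
        using N c \<open>p \<noteq> q\<close> unfolding F_def separated_def by cases blast+
    qed
    then have "\<Union>c \<in> F" using c by (auto simp: F_def)
    then show "\<exists>U\<in>F. \<forall>N\<in>c. N \<subseteq> U" by blast
  qed
  then obtain N where N: "N \<in> F" and max: "\<And>N'. N' \<in> F \<Longrightarrow> N \<subseteq> N' \<Longrightarrow> N' = N" by blast
  show thesis
  proof (rule that)
    show "N \<subseteq> A" "separated e N" using N by (auto simp: F_def)
    fix a assume a: "a \<in> A"
    show "\<exists>p\<in>N. d p a < e"
    proof (rule ccontr)
      assume far: "\<not> ?thesis"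
      then have "insert a N \<in> F"
        using N a by (force simp: F_def separated_def commute)
      then have "a \<in> N" using max by blast
      moreover have "d a a = 0" using a assms by auto
      ultimately show False using far assms by auto
    qed
  qed
qed

definition neighbourhood :: "'a set \<Rightarrow> real \<Rightarrow> 'a set" where
  "neighbourhood A u = {x \<in> M. \<exists>a\<in>A. d a x < u}"

lemma neighbourhood_mono: "u \<le> v \<Longrightarrow> neighbourhood A u \<subseteq> neighbourhood A v"
  by (force simp: neighbourhood_def)

end

text \<open>The real parameter \<open>R\<close> replaces half the diameter, which may be infinite,
  and can be varied while \<open>C\<close> and \<open>Q\<close> stay fixed.\<close>

locale regular_space = Metric_space X d for X :: "'a set" and d +
  fixes Q C R :: real
  assumes Q: "Q > 0" and C: "C \<ge> 1" and R: "R > 0"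
    and ball_lower: "x \<in> X \<Longrightarrow> 0 < r \<Longrightarrow> r < R \<Longrightarrow>
      ennreal (1 / C * r powr Q) \<le> hausdorff_measure X d Q (mball x r)"
    and ball_upper: "x \<in> X \<Longrightarrow> 0 < r \<Longrightarrow> r < R \<Longrightarrow>
      hausdorff_measure X d Q (mball x r) \<le> ennreal (C * r powr Q)"
begin

abbreviation \<mu> :: "'a set \<Rightarrow> ennreal" where
  "\<mu> \<equiv> hausdorff_measure X d Q"

text \<open>Chosen such that \<open>C * (lam * r) powr Q = r powr Q / (2 * C)\<close>.\<close>

definition lam :: real where
  "lam = (1 / (2 * C\<^sup>2)) powr (1 / Q)"

lemma lam_pos: "0 < lam" and lam_less_1: "lam < 1"
proof -
  have "1 \<le> C\<^sup>2" using C by (simp add: one_le_power)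
  then have "1 < 2 * C\<^sup>2" by linarith
  then have "1 / (2 * C\<^sup>2) < 1" "0 < 1 / (2 * C\<^sup>2)" using C by (auto simp: field_simps)
  then show "0 < lam" "lam < 1"
    unfolding lam_def using Q powr_less_mono2[of "1 / Q" "1 / (2 * C\<^sup>2)" 1] by auto
qed

text \<open>If the annulus were empty, both balls would have the same measure; but by the choice of
  \<open>lam\<close> the upper bound for the smaller one is half the lower bound for the larger
  one.\<close>

lemma ex_point_in_annulus:
  assumes "x \<in> X" "0 < r" "r < R"
  obtains q where "q \<in> X" "lam * r \<le> d x q" "d x q < r"
proof -
  have "\<not> mball x r \<subseteq> mball x (lam * r)"
  proof
    assume "mball x r \<subseteq> mball x (lam * r)"
    then have "\<mu> (mball x r) \<le> \<mu> (mball x (lam * r))" by (rule hausdorff_measure_mono)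
    moreover have "\<mu> (mball x (lam * r)) \<le> ennreal (C * (lam * r) powr Q)"
      using assms lam_pos lam_less_1 by (intro ball_upper) (auto intro: less_trans[of _ r])
    ultimately have "ennreal (1 / C * r powr Q) \<le> ennreal (C * (lam * r) powr Q)"
      using ball_lower[OF assms] by (meson order_trans)
    then have "1 / C * r powr Q \<le> C * (lam * r) powr Q"
      using C by (subst (asm) ennreal_le_iff) auto
    also have "(lam * r) powr Q = 1 / (2 * C\<^sup>2) * r powr Q"
      using Q by (simp add: lam_def powr_mult powr_powr)
    finally have "1 / C \<le> 1 / (2 * C)"
      using C assms by (simp add: power2_eq_square field_simps)
    then show False using C by (simp add: field_simps)
  qed
  then show thesis using that by (meson in_mball not_less subsetI)
qed

text \<open>Each hole of size \<open>\<eta> * t\<close> takes a fixed proportion \<open>c\<close> of the mass of the ball of size \<open>t\<close> around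
  it, so the infimum \<open>m\<close> of the masses of the neighbourhoods of \<open>A\<close> satisfies \<open>m + c * m \<le> m\<close>. The holes
  lie at a positive distance from each other and from the smaller neighbourhood, so no measurability
  is needed.\<close>

lemma porous_null_set:
  assumes A: "A \<subseteq> mball x0 (R/2)" and \<eta>: "0 < \<eta>" "\<eta> \<le> 1" and K: "K > 0"
    and porous: "\<And>u. u > 0 \<Longrightarrow> \<exists>t>0. t < u \<and> (\<forall>a\<in>A. \<exists>w\<in>X. d a w \<le> K * t \<and> mball w (\<eta> * t) \<inter> A = {})"
  shows "\<mu> A = 0"
proof -
  define U where "U u = neighbourhood A u" for u
  define m where "m = (INF u\<in>{0<..}. \<mu> (U u))"
  \<comment> \<open>The ratio of the lower bound for a ball of radius \<open>\<eta> * t / 4\<close>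
    to the upper bound for a ball of radius \<open>5 * (K + 1) * t\<close>; it does not depend on
    \<open>t\<close>.\<close>
  define c where "c = (\<eta> / (20 * (K + 1))) powr Q / C\<^sup>2"
  have AX: "A \<subseteq> X" using A by auto
  have U_mono: "u \<le> v \<Longrightarrow> U u \<subseteq> U v" for u v by (simp add: U_def neighbourhood_mono)
  have U_iff: "x \<in> U u \<longleftrightarrow> x \<in> X \<and> (\<exists>a\<in>A. d a x < u)" for x u by (auto simp: U_def neighbourhood_def)
  have c: "c > 0" using \<eta> K C by (simp add: c_def)
  have U_fin: "\<mu> (U u) < top" if "u \<le> R/4" for u
  proof (cases "U u = {}")
    case False
    then have x0: "x0 \<in> X" using A by (force simp: U_iff)
    have "U u \<subseteq> mball x0 (3 * R / 4)"
    proof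
      fix x assume "x \<in> U u"
      then obtain a where a: "x \<in> X" "a \<in> A" "d a x < u" by (auto simp: U_iff)
      then have "d x0 a < R/2" "a \<in> X" using A by auto
      then show "x \<in> mball x0 (3 * R / 4)"
        using triangle[of x0 a x] x0 a that by auto
    qed
    then have "\<mu> (U u) \<le> \<mu> (mball x0 (3 * R / 4))" by (rule hausdorff_measure_mono)
    also have "\<dots> \<le> ennreal (C * (3 * R / 4) powr Q)" using x0 R by (intro ball_upper) auto
    finally show ?thesis using ennreal_less_top order_le_less_trans by blast
  qed simp
  have m_le: "m \<le> \<mu> (U u)" if "u > 0" for u unfolding m_def using that by (intro INF_lower) auto
  have decay: "m + ennreal c * m \<le> \<mu> (U u)" if "u > 0" for u
  proof -
    define u' where "u' = min u (R/10) / (K + 1)"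
    have "u' > 0" using \<open>u > 0\<close> R K by (simp add: u'_def)
    then obtain t where t: "t > 0" "t < u'"
      and hole: "\<forall>a\<in>A. \<exists>w\<in>X. d a w \<le> K * t \<and> mball w (\<eta> * t) \<inter> A = {}"
      using porous by blast
    define k where "k = (K + 1) * t"
    have "k > 0" "t < k" "K * t + t = k"
      using t K by (simp_all add: k_def distrib_right add_pos_pos)
    moreover have "k < u" "k < R/10"
      using t K by (auto simp: k_def u'_def field_simps)
    ultimately have k: "k < u" "k < R/10" "k > 0" "t < k" "K * t + t = k" by auto
    have \<eta>t: "0 < \<eta> * t" "\<eta> * t \<le> t" using \<eta> t by auto
    obtain w where w: "\<And>a. a \<in> A \<Longrightarrow> w a \<in> X \<and> d a (w a) \<le> K * t \<and> mball (w a) (\<eta> * t) \<inter> A = {}"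
      using hole by metis
    \<comment> \<open>Taking a quarter of the hole keeps \<open>W a\<close> at distance
      \<open>\<eta> * t / 2\<close> from the \<open>\<eta> * t / 4\<close>-neighbourhood of
      \<open>A\<close>.\<close>
    define W where "W a = mball (w a) (\<eta> * t / 4)" for a
    define v where "v = 1 / C * (\<eta> * t / 4) powr Q"
    have v: "v > 0" using C \<eta> t by (simp add: v_def)
    have W_lower: "ennreal v \<le> \<mu> (W a)" if "a \<in> A" for a
      unfolding v_def W_def using w[OF that] \<eta>t k by (intro ball_lower) auto
    have W_near: "x \<in> X \<and> d a x < k" if "a \<in> A" "x \<in> W a" for a x
    proof -
      have x: "x \<in> X" "d (w a) x < \<eta> * t / 4" using that(2) by (auto simp: W_def)
      then show ?thesis
        using w[OF that(1)] triangle[of a "w a" x] AX that(1) k \<eta>t by fastforce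
    qed
    then have W_sub: "W a \<subseteq> U k" if "a \<in> A" for a
      using that unfolding U_iff[THEN eq_reflection] subset_iff by blast
    obtain P where P: "P \<subseteq> A" "separated (4 * k) P" and near: "\<And>a. a \<in> A \<Longrightarrow> \<exists>p\<in>P. d p a < 4 * k"
      using ex_maximal_separated[OF AX, of "4 * k"] k by auto
    have W_sep: "\<eta> * t / 2 \<le> d x y" if "a \<in> P" "b \<in> P" "a \<noteq> b" "x \<in> W a" "y \<in> W b" for a b x y
    proof -
      have ab: "4 * k \<le> d a b" "a \<in> X" "b \<in> X" using P AX that unfolding separated_def by auto
      have "d a x < k" "d b y < k" "x \<in> X" "y \<in> X"
        using that W_near P by auto
      then show ?thesis
        using triangle[of a x b] triangle[of x y b] ab commute[of b y] k \<eta>t by linarith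
    qed
    have sum_le: "of_nat (card F) * ennreal v \<le> (\<Sum>a\<in>F. \<mu> (W a))" if "F \<subseteq> P" for F
      using sum_mono[of F "\<lambda>_. ennreal v" "\<lambda>a. \<mu> (W a)"] W_lower that P by auto
    \<comment> \<open>The sets \<open>W a\<close> are separated, each has mass at least
      \<open>v\<close>, and together they lie in \<open>U k\<close>, which has finite mass.\<close>
    have "finite P \<and> card P \<le> nat \<lceil>enn2real (\<mu> (U k)) / v\<rceil>"
    proof (rule finite_if_finite_subsets_card_bdd)
      fix F assume F: "F \<subseteq> P" "finite F"
      have "of_nat (card F) * ennreal v \<le> (\<Sum>a\<in>F. \<mu> (W a))" by (rule sum_le[OF F(1)])
      also have "\<dots> \<le> \<mu> (\<Union>a\<in>F. W a)"
      proof (rule hausdorff_measure_separated_sum_le)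
        fix a b x y assume "a \<in> F" "b \<in> F" "a \<noteq> b" "x \<in> W a" "y \<in> W b"
        then show "\<eta> * t / 2 \<le> d x y" using F by (intro W_sep[of a b]) auto
      qed (use F \<eta>t in auto)
      also have "\<dots> \<le> \<mu> (U k)"
        using W_sub F P by (intro hausdorff_measure_mono) blast
      finally have "ennreal (real (card F) * v) \<le> \<mu> (U k)"
        using v by (simp add: ennreal_mult ennreal_of_nat_eq_real_of_nat)
      then have "real (card F) * v \<le> enn2real (\<mu> (U k))"
        using enn2real_mono[OF _ U_fin[of k]] k v by fastforce
      then have "real (card F) \<le> enn2real (\<mu> (U k)) / v" using v by (simp add: field_simps)
      then show "card F \<le> nat \<lceil>enn2real (\<mu> (U k)) / v\<rceil>" by linarith
    qed
    then have finP: "finite P" ..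
    have "U k \<subseteq> (\<Union>a\<in>P. mball a (5 * k))"
    proof
      fix x assume "x \<in> U k"
      then obtain a where a: "x \<in> X" "a \<in> A" "d a x < k" by (auto simp: U_iff)
      obtain p where p: "p \<in> P" "d p a < 4 * k" using near[OF a(2)] by blast
      have "p \<in> X" "a \<in> X" using p P AX a by auto
      then have "x \<in> mball p (5 * k)" using triangle[of p a x] a p by auto
      then show "x \<in> (\<Union>a\<in>P. mball a (5 * k))" using p by blast
    qed
    then have "\<mu> (U k) \<le> \<mu> (\<Union>a\<in>P. mball a (5 * k))" by (rule hausdorff_measure_mono)
    also have "\<dots> \<le> (\<Sum>a\<in>P. \<mu> (mball a (5 * k)))" by (rule hausdorff_measure_finite_UN_le[OF finP])
    also have "\<dots> \<le> (\<Sum>a\<in>P. ennreal (C * (5 * k) powr Q))"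
      using P AX k by (intro sum_mono ball_upper) auto
    finally have up: "\<mu> (U k) \<le> of_nat (card P) * ennreal (C * (5 * k) powr Q)" by simp
    have cv: "c * (C * (5 * k) powr Q) = v"
    proof -
      have "\<eta> / (20 * (K + 1)) * (5 * k) = \<eta> * t / 4" using K by (simp add: k_def field_simps)
      then have "(\<eta> / (20 * (K + 1))) powr Q * (5 * k) powr Q = (\<eta> * t / 4) powr Q"
        by (metis powr_mult)
      then show ?thesis using C by (simp add: c_def v_def power2_eq_square field_simps)
    qed
    \<comment> \<open>The \<open>5 * k\<close>-balls around \<open>P\<close> cover
      \<open>U k\<close>, so the holes together carry at least the share \<open>c\<close> of its
      mass.\<close>
    have "ennreal c * \<mu> (U k) \<le> ennreal c * (of_nat (card P) * ennreal (C * (5 * k) powr Q))"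
      by (intro mult_left_mono up) auto
    also have "\<dots> = of_nat (card P) * ennreal v"
      using c C by (simp add: cv[symmetric] ennreal_mult mult.left_commute)
    also have "\<dots> \<le> (\<Sum>a\<in>P. \<mu> (W a))" by (rule sum_le) simp
    also have "\<dots> \<le> \<mu> (\<Union>a\<in>P. W a)"
    proof (rule hausdorff_measure_separated_sum_le)
      fix a b x y assume "a \<in> P" "b \<in> P" "a \<noteq> b" "x \<in> W a" "y \<in> W b"
      then show "\<eta> * t / 2 \<le> d x y" by (intro W_sep[of a b]) auto
    qed (use finP \<eta>t in auto)
    finally have W_big: "ennreal c * \<mu> (U k) \<le> \<mu> (\<Union>a\<in>P. W a)" .
    have "m + ennreal c * m \<le> \<mu> (U (\<eta> * t / 4)) + ennreal c * \<mu> (U k)"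
      using \<eta>t k by (intro add_mono mult_left_mono m_le) auto
    also have "\<dots> \<le> \<mu> (U (\<eta> * t / 4)) + \<mu> (\<Union>a\<in>P. W a)" by (intro add_left_mono W_big)
    also have "\<dots> \<le> \<mu> (U (\<eta> * t / 4) \<union> (\<Union>a\<in>P. W a))"
    proof (rule hausdorff_measure_separated_superadditive)
      show "\<eta> * t / 2 > 0" using \<eta>t by simp
      fix x y assume "x \<in> U (\<eta> * t / 4)" "y \<in> (\<Union>a\<in>P. W a)"
      then obtain a b where ab: "x \<in> X" "a \<in> A" "d a x < \<eta> * t / 4" "b \<in> P" "y \<in> W b" by (auto simp: U_iff)
      then have y: "y \<in> X" "d (w b) y < \<eta> * t / 4" "w b \<in> X" "a \<in> X" "b \<in> A" using AX P by (auto simp: W_def)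
      then have "a \<notin> mball (w b) (\<eta> * t)" using w[of b] ab by blast
      then have "\<eta> * t \<le> d (w b) a" using y by auto
      then show "\<eta> * t / 2 \<le> d x y"
        using triangle[of "w b" y a] triangle[of y x a] commute[of a x] commute[of x y] ab y by linarith
    qed
    also have "\<dots> \<le> \<mu> (U u)"
    proof (rule hausdorff_measure_mono)
      have "U (\<eta> * t / 4) \<subseteq> U u" "U k \<subseteq> U u" using \<eta>t k by (auto intro!: U_mono)
      then show "U (\<eta> * t / 4) \<union> (\<Union>a\<in>P. W a) \<subseteq> U u" using W_sub P by blast
    qed
    finally show ?thesis .
  qed
  have "m + ennreal c * m \<le> m"
    unfolding m_def[symmetric] using decay by (subst (3) m_def, intro INF_greatest) auto
  moreover have "m < top" using m_le[of "R/4"] U_fin[of "R/4"] R by (simp add: order_le_less_trans)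
  ultimately have "m = 0"
    using c by (cases m) (auto simp: ennreal_mult[symmetric] ennreal_plus[symmetric] mult_le_0_iff simp del: ennreal_plus)
  moreover have "\<mu> A \<le> m"
    unfolding m_def
  proof (rule INF_greatest)
    fix u :: real assume "u \<in> {0<..}"
    then have "A \<subseteq> U u" using AX by (force simp: U_iff)
    then show "\<mu> A \<le> \<mu> (U u)" by (rule hausdorff_measure_mono)
  qed
  ultimately show ?thesis by simp
qed

end

section \<open>The shortcut distance\<close>

context Metric_space
begin

text \<open>Provides the Lipschitz bound for the test functions of \<open>shortcut_ge_small\<close>
  and \<open>shortcut_ge_large\<close>. Nonnegativity bounds each family from below, as the real
  infimum requires.\<close>

lemma abs_INF_diff_le:
  fixes k :: "'i \<Rightarrow> 'a \<Rightarrow> real"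
  assumes "I \<noteq> {}" and nonneg: "\<And>i w. i \<in> I \<Longrightarrow> 0 \<le> k i w"
    and lip: "\<And>i w w'. i \<in> I \<Longrightarrow> w \<in> M \<Longrightarrow> w' \<in> M \<Longrightarrow> k i w \<le> k i w' + L * d w w'"
    and w: "w \<in> M" "w' \<in> M"
  shows "\<bar>(INF i\<in>I. k i w) - (INF i\<in>I. k i w')\<bar> \<le> L * d w w'"
proof -
  have *: "(INF i\<in>I. k i w) - L * d w w' \<le> (INF i\<in>I. k i w')" if "w \<in> M" "w' \<in> M" for w w'
  proof (rule cINF_greatest)
    fix i assume i: "i \<in> I"
    have "(INF i\<in>I. k i w) \<le> k i w"
      using i nonneg by (intro cINF_lower bdd_belowI[of _ 0]) auto
    then show "(INF i\<in>I. k i w) - L * d w w' \<le> k i w'" using lip[OF i that] by linarith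
  qed fact
  show ?thesis using *[OF w] *[OF w(2,1)] unfolding commute[of w' w] by linarith
qed

end

locale snowflake_space = regular_space X d Q C R for X :: "'a set" and d Q C R +
  fixes \<delta> :: real
  assumes \<delta>: "0 < \<delta>" "\<delta> < 1"
begin

section \<open>Scales and costs of the shortcuts\<close>

definition eps :: "nat \<Rightarrow> real" where
  "eps n = 1 / (real n + 2)"

text \<open>The last factor is chosen as follows: over a length of at most
  \<open>eps j powr (1 / (1 - \<delta>))\<close> times \<open>r powr (1 / \<delta>)\<close>, a
  function of slope \<open>r / r powr (1 / \<delta>)\<close> varies by at most \<open>eps j\<close>
  times the snowflaked length. The start \<open>R / 100\<close> leaves room for enlarging balls by
  the factor 27.\<close>

primrec radius :: "nat \<Rightarrow> real" where
  "radius 0 = R / 100"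
| "radius (Suc n) = (eps n * radius n powr \<delta>) powr (1 / \<delta>) * eps (Suc n) powr (1 / (1 - \<delta>))"

definition cost :: "nat \<Rightarrow> real" where
  "cost n = eps n * radius n powr \<delta>"

lemma eps: "0 < eps n" "eps n \<le> 1/2" "eps (Suc n) \<le> eps n"
  by (auto simp: eps_def field_simps)

lemma eps_tendsto: "eps \<longlonglongrightarrow> 0"
  using LIMSEQ_ignore_initial_segment[OF lim_1_over_n, of 2] by (simp add: eps_def[abs_def] add.commute)

lemma radius_pos: "0 < radius n"
proof (induction n)
  case (Suc n)
  then show ?case using eps[of n] eps[of "Suc n"] by simp
qed (use R in simp)

lemma cost_pos: "0 < cost n"
  using eps(1)[of n] radius_pos[of n] by (simp add: cost_def)

lemma radius_Suc: "radius (Suc n) = cost n powr (1 / \<delta>) * eps (Suc n) powr (1 / (1 - \<delta>))"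
  by (simp add: cost_def)

declare radius.simps(2) [simp del]

text \<open>Together with \<open>radius_Suc\<close> this interlaces the scales:
  \<open>radius (Suc n)\<close> lies below the length whose snowflake is \<open>cost n\<close>, and
  that length lies below \<open>radius n\<close>.\<close>

lemma cost_root_le: "cost n powr (1 / \<delta>) \<le> radius n / 2"
proof -
  have "cost n powr (1 / \<delta>) = eps n powr (1 / \<delta>) * radius n"
    using \<delta> radius_pos[of n] by (simp add: cost_def powr_mult powr_powr)
  also have "eps n powr (1 / \<delta>) \<le> eps n powr 1"
    using eps[of n] \<delta> by (intro powr_mono') auto
  also have "eps n powr 1 \<le> 1/2" using eps[of n] by simp
  finally show ?thesis using radius_pos[of n] by (simp add: mult_right_mono)
qed

lemma radius_Suc_le: "radius (Suc n) \<le> radius n / 2"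
proof -
  have "eps (Suc n) powr (1 / (1 - \<delta>)) \<le> 1"
    using eps[of "Suc n"] \<delta> by (intro powr_le1) auto
  then have "radius (Suc n) \<le> cost n powr (1 / \<delta>) * 1"
    unfolding radius_Suc by (intro mult_left_mono) auto
  then show ?thesis using cost_root_le[of n] by simp
qed

lemma decseq_radius: "decseq radius"
proof (rule decseq_SucI)
  show "radius (Suc n) \<le> radius n" for n
    using radius_Suc_le[of n] radius_pos[of n] by linarith
qed

lemma radius_tendsto: "radius \<longlonglongrightarrow> 0"
proof (rule real_tendsto_sandwich[of "\<lambda>_. 0" _ _ "\<lambda>n. radius 0 * (1/2) ^ n"])
  have "radius n \<le> radius 0 * (1/2) ^ n" for n
  proof (induction n)
    case (Suc n)
    then show ?case using radius_Suc_le[of n] by simp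
  qed simp
  then show "\<forall>\<^sub>F n in sequentially. radius n \<le> radius 0 * (1/2) ^ n" by simp
  show "(\<lambda>n. radius 0 * (1/2) ^ n) \<longlonglongrightarrow> 0"
    by (intro tendsto_mult_right_zero LIMSEQ_power_zero) simp
  show "\<forall>\<^sub>F n in sequentially. 0 \<le> radius n" using radius_pos by (simp add: less_imp_le)
qed simp

lemma decseq_cost: "decseq cost"
proof (rule decseq_SucI)
  fix n
  have "radius (Suc n) powr \<delta> \<le> radius n powr \<delta>"
    using decseq_SucD[OF decseq_radius, of n] radius_pos[of "Suc n"] \<delta> by (intro powr_mono2) auto
  then show "cost (Suc n) \<le> cost n"
    unfolding cost_def using eps by (intro mult_mono) (auto simp: less_imp_le)
qed

lemma cost_antimono: "m \<le> n \<Longrightarrow> cost n \<le> cost m"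
  using decseq_cost by (rule decseqD)

lemma ex_cost_le: assumes "r > 0" shows "\<exists>n. cost n \<le> r"
proof -
  have "(\<lambda>n. eps n * radius 0 powr \<delta>) \<longlonglongrightarrow> 0"
    using tendsto_mult_right[OF eps_tendsto, of "radius 0 powr \<delta>"] by simp
  then have "\<forall>\<^sub>F n in sequentially. eps n * radius 0 powr \<delta> < r"
    by (rule order_tendstoD) fact
  then obtain n where "eps n * radius 0 powr \<delta> < r"
    using eventually_happens' sequentially_bot by blast
  moreover have "radius n powr \<delta> \<le> radius 0 powr \<delta>"
    using decseqD[OF decseq_radius, of 0 n] radius_pos[of n] \<delta> by (intro powr_mono2) auto
  then have "cost n \<le> eps n * radius 0 powr \<delta>"
    unfolding cost_def using eps(1)[of n] by simp
  ultimately show ?thesis by (intro exI[of _ n]) simp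
qed

section \<open>Nets and their partner points\<close>

definition net :: "nat \<Rightarrow> 'a set" where
  "net n = (SOME N. N \<subseteq> X \<and> separated (8 * radius n) N \<and> (\<forall>a\<in>X. \<exists>p\<in>N. d p a < 8 * radius n))"

lemma net: "net n \<subseteq> X" "separated (8 * radius n) (net n)" "a \<in> X \<Longrightarrow> \<exists>p\<in>net n. d p a < 8 * radius n"
proof -
  have "\<exists>N. N \<subseteq> X \<and> separated (8 * radius n) N \<and> (\<forall>a\<in>X. \<exists>p\<in>N. d p a < 8 * radius n)"
    using ex_maximal_separated[of X "8 * radius n"] radius_pos[of n] by (metis mult_pos_pos order_refl zero_less_numeral)
  from someI_ex[OF this] show "net n \<subseteq> X" "separated (8 * radius n) (net n)"
      "a \<in> X \<Longrightarrow> \<exists>p\<in>net n. d p a < 8 * radius n"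
    unfolding net_def by auto
qed

text \<open>Pairs are shorter than \<open>radius n\<close>, while the net is
  \<open>8 * radius n\<close>-separated, so distinct pairs of one level are far apart compared with
  their size.\<close>

definition partner :: "nat \<Rightarrow> 'a \<Rightarrow> 'a" where
  "partner n p = (SOME q. q \<in> X \<and> lam * radius n \<le> d p q \<and> d p q < radius n)"

lemma partner:
  assumes "p \<in> net n"
  shows "partner n p \<in> X" "lam * radius n \<le> d p (partner n p)" "d p (partner n p) < radius n"
proof -
  have "radius n < R" using decseqD[OF decseq_radius, of 0 n] R by simp
  moreover have "p \<in> X" using net(1) assms by blast
  ultimately obtain q where "q \<in> X" "lam * radius n \<le> d p q" "d p q < radius n"
    using ex_point_in_annulus radius_pos by blast
  then have "\<exists>q. q \<in> X \<and> lam * radius n \<le> d p q \<and> d p q < radius n" by blast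
  from someI_ex[OF this] show "partner n p \<in> X" "lam * radius n \<le> d p (partner n p)" "d p (partner n p) < radius n"
    unfolding partner_def by auto
qed

text \<open>\<open>shortcut\<close> is the largest distance below \<open>d\<^sup>\<delta>\<close> (and \<open>cost 0\<close>) that gives each pair
  \<open>p, partner n p\<close> at most the length \<open>cost n\<close>. Writing it as a supremum over functions, rather
  than as an infimum over chains, reduces lower bounds to the choice of one function. The bound by
  \<open>cost 0\<close> keeps the diameter, hence the radii tested for regularity, small.\<close>

definition admissible :: "('a \<Rightarrow> real) \<Rightarrow> bool" where
  "admissible f \<longleftrightarrow> (\<forall>x\<in>X. \<forall>y\<in>X. \<bar>f x - f y\<bar> \<le> snowflake d \<delta> x y \<and> \<bar>f x - f y\<bar> \<le> cost 0) \<and>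
     (\<forall>n. \<forall>p\<in>net n. \<bar>f p - f (partner n p)\<bar> \<le> cost n)"

definition shortcut :: "'a \<Rightarrow> 'a \<Rightarrow> real" where
  "shortcut x y = (if x \<in> X \<and> y \<in> X then SUP f\<in>{f. admissible f}. \<bar>f x - f y\<bar> else 0)"

section \<open>Basic properties of the shortcut distance\<close>

lemma admissible_zero: "admissible (\<lambda>_. 0)"
  using cost_pos by (simp add: admissible_def snowflake_def less_imp_le)

lemma shortcut_upper:
  assumes "admissible f" "x \<in> X" "y \<in> X"
  shows "\<bar>f x - f y\<bar> \<le> shortcut x y"
proof -
  have "bdd_above ((\<lambda>f. \<bar>f x - f y\<bar>) ` {f. admissible f})"
    using assms(2,3) by (intro bdd_aboveI[of _ "cost 0"]) (auto simp: admissible_def)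
  then show ?thesis
    unfolding shortcut_def using assms by (auto intro!: cSUP_upper)
qed

lemma shortcut_least:
  assumes "\<And>f. admissible f \<Longrightarrow> \<bar>f x - f y\<bar> \<le> b" "x \<in> X" "y \<in> X"
  shows "shortcut x y \<le> b"
  unfolding shortcut_def using assms admissible_zero by (auto intro!: cSUP_least)

lemma shortcut_le_snowflake: "x \<in> X \<Longrightarrow> y \<in> X \<Longrightarrow> shortcut x y \<le> snowflake d \<delta> x y"
  by (rule shortcut_least) (auto simp: admissible_def)

lemma shortcut_le_cost_0: "x \<in> X \<Longrightarrow> y \<in> X \<Longrightarrow> shortcut x y \<le> cost 0"
  by (rule shortcut_least) (auto simp: admissible_def)

lemma shortcut_partner_le: "p \<in> net n \<Longrightarrow> shortcut p (partner n p) \<le> cost n"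
  using net(1)[of n] partner(1)[of p n] by (intro shortcut_least) (auto simp: admissible_def)

section \<open>Test functions and lower bounds for the shortcut distance\<close>

definition slope :: "real \<Rightarrow> real" where
  "slope r = r / r powr (1 / \<delta>)"

lemma slope_pos: "r > 0 \<Longrightarrow> slope r > 0"
  by (simp add: slope_def)

lemma slope_eq: "r > 0 \<Longrightarrow> slope r = (r powr (1 / \<delta>)) powr (\<delta> - 1)"
proof -
  assume r: "r > 0"
  have "slope r = r powr 1 / r powr (1 / \<delta>)" using r by (simp add: slope_def)
  also have "\<dots> = r powr (1 - 1 / \<delta>)" by (rule powr_diff[symmetric])
  also have "1 - 1 / \<delta> = 1 / \<delta> * (\<delta> - 1)" using \<delta> by (simp add: field_simps)
  finally show ?thesis by (simp add: powr_powr)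
qed

text \<open>By concavity the power function lies above its chord from 0 to
  \<open>r powr (1 / \<delta>)\<close>, where it takes the value \<open>r\<close>;
  \<open>slope r\<close> is the slope of this chord.\<close>

lemma slope_mult_le:
  assumes "r > 0" "0 \<le> a" "a \<le> r powr (1 / \<delta>)"
  shows "slope r * a \<le> a powr \<delta>"
proof (cases "a = 0")
  case False
  have "(r powr (1 / \<delta>)) powr (\<delta> - 1) \<le> a powr (\<delta> - 1)"
    using assms False \<delta> by (intro powr_mono2') auto
  then have "slope r * a \<le> a powr (\<delta> - 1) * a"
    using assms by (simp add: slope_eq mult_right_mono)
  also have "\<dots> = a powr \<delta>" using powr_add[of a "\<delta> - 1" 1] assms False by simp
  finally show ?thesis .
qed simp

text \<open>The scales decay so fast that a function which is Lipschitz for \<open>d\<close>, rather than only for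
  \<open>d\<^sup>\<delta>\<close>, does not notice the shortcuts at much smaller scales.\<close>

lemma slope_radius_le:
  assumes r: "cost n \<le> r" and nj: "n < j"
  shows "slope r * radius j \<le> cost j"
proof -
  have r0: "r > 0" using r cost_pos[of n] by linarith
  define T where "T = r powr (1 / \<delta>)"
  have T: "T > 0" using r0 by (simp add: T_def)
  obtain i where i: "j = Suc i" "n \<le> i" using nj by (cases j) auto
  have "cost i powr (1 / \<delta>) \<le> T"
    unfolding T_def using cost_antimono[OF i(2)] r cost_pos[of i] \<delta> by (intro powr_mono2) auto
  then have "radius j \<le> T * eps j powr (1 / (1 - \<delta>))"
    unfolding i(1) radius_Suc by (intro mult_right_mono) auto
  then have "radius j powr (1 - \<delta>) \<le> (T * eps j powr (1 / (1 - \<delta>))) powr (1 - \<delta>)"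
    using radius_pos[of j] \<delta> by (intro powr_mono2) auto
  also have "\<dots> = T powr (1 - \<delta>) * eps j"
    using \<delta> eps(1)[of j] by (simp add: powr_mult powr_powr)
  finally have le: "radius j powr (1 - \<delta>) \<le> T powr (1 - \<delta>) * eps j" .
  have "slope r * radius j = T powr (\<delta> - 1) * (radius j powr (1 - \<delta>) * radius j powr \<delta>)"
    using slope_eq[OF r0] powr_add[of "radius j" "1 - \<delta>" \<delta>] radius_pos[of j] by (simp add: T_def)
  also have "\<dots> \<le> T powr (\<delta> - 1) * (T powr (1 - \<delta>) * eps j * radius j powr \<delta>)"
    by (intro mult_left_mono mult_right_mono le) auto
  also have "\<dots> = (T powr (\<delta> - 1) * T powr (1 - \<delta>)) * cost j"
    by (simp add: cost_def)
  also have "T powr (\<delta> - 1) * T powr (1 - \<delta>) = 1"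
    using T powr_add[of T "\<delta> - 1" "1 - \<delta>"] by simp
  finally show ?thesis by simp
qed

text \<open>The range bound \<open>r\<close> settles distances beyond
  \<open>r powr (1 / \<delta>)\<close> and the pairs of levels before \<open>n\<close>; the slope
  settles shorter distances and the levels after \<open>n\<close>. Only the pairs of level
  \<open>n\<close> remain as a hypothesis.\<close>

lemma admissibleI:
  assumes r: "cost n \<le> r" "\<And>m. m < n \<Longrightarrow> r \<le> cost m" "r \<le> cost 0"
    and lip: "\<And>x y. x \<in> X \<Longrightarrow> y \<in> X \<Longrightarrow> \<bar>g x - g y\<bar> \<le> slope r * d x y"
    and bound: "\<And>x y. x \<in> X \<Longrightarrow> y \<in> X \<Longrightarrow> \<bar>g x - g y\<bar> \<le> r"
    and pair: "\<And>p. p \<in> net n \<Longrightarrow> \<bar>g p - g (partner n p)\<bar> \<le> cost n"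
  shows "admissible g"
  unfolding admissible_def
proof (intro conjI ballI allI)
  have r0: "r > 0" using r(1) cost_pos[of n] by linarith
  fix x y assume x: "x \<in> X" and y: "y \<in> X"
  show "\<bar>g x - g y\<bar> \<le> cost 0" using bound[OF x y] r(3) by linarith
  show "\<bar>g x - g y\<bar> \<le> snowflake d \<delta> x y"
  proof (cases "d x y \<le> r powr (1 / \<delta>)")
    case True
    then show ?thesis using lip[OF x y] slope_mult_le[OF r0 nonneg True] by (simp add: snowflake_def)
  next
    case False
    then have "r \<le> d x y powr \<delta>"
      using powr_less_powr_inverse_iff[OF \<delta>(1), of "d x y" r] r0 by simp
    then show ?thesis using bound[OF x y] by (simp add: snowflake_def)
  qed
next
  have r0: "r > 0" using r(1) cost_pos[of n] by linarith
  fix j p assume p: "p \<in> net j"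
  have pX: "p \<in> X" "partner j p \<in> X" using p net(1) partner(1) by auto
  consider "j < n" | "j = n" | "n < j" by linarith
  then show "\<bar>g p - g (partner j p)\<bar> \<le> cost j"
  proof cases
    case 1
    then show ?thesis using bound[OF pX] r(2)[OF 1] by linarith
  next
    case 2
    then show ?thesis using pair p by simp
  next
    case 3
    have "slope r * d p (partner j p) \<le> slope r * radius j"
      using partner(3)[OF p] slope_pos[OF r0] by simp
    then show ?thesis using lip[OF pX] slope_radius_le[OF r(1) 3] by linarith
  qed
qed

text \<open>The witness is a multiple of the distance to \<open>x\<close>, truncated at
  \<open>cost 0\<close>.\<close>

lemma shortcut_pos:
  assumes "x \<in> X" "y \<in> X" "x \<noteq> y"
  shows "0 < shortcut x y"
proof -
  define L where "L = slope (cost 0)"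
  have L: "L > 0" unfolding L_def by (rule slope_pos[OF cost_pos])
  define g where "g w = min (cost 0) (L * d x w)" for w
  have lip: "\<bar>g w - g w'\<bar> \<le> L * d w w'" if "w \<in> X" "w' \<in> X" for w w'
  proof -
    have "d x w - d x w' \<le> d w w'" "d x w' - d x w \<le> d w w'"
      using triangle[of x w w'] triangle[of x w' w] commute[of w w'] that assms by linarith+
    then have "L * d x w - L * d x w' \<le> L * d w w'" "L * d x w' - L * d x w \<le> L * d w w'"
      using L by (simp_all flip: right_diff_distrib)
    then show ?thesis by (simp add: g_def)
  qed
  have "admissible g"
  \<comment> \<open>Level 1 rather than 0: the range \<open>cost 0\<close> settles the pairs of
    level 0, and the slope is small enough for all later levels, level 1 included.\<close>
  proof (rule admissibleI[of 1 "cost 0"])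
    fix p assume p: "p \<in> net 1"
    then have pX: "p \<in> X" "partner 1 p \<in> X" using net(1) partner(1) by auto
    have "L * d p (partner 1 p) \<le> L * radius 1" using partner(3)[OF p] L by simp
    also have "\<dots> \<le> cost 1" unfolding L_def by (rule slope_radius_le[of 0]) auto
    finally show "\<bar>g p - g (partner 1 p)\<bar> \<le> cost 1" using lip[OF pX] by linarith
  next
    have "0 \<le> g w \<and> g w \<le> cost 0" for w
      using L cost_pos[of 0] by (simp add: g_def)
    then show "\<bar>g w - g w'\<bar> \<le> cost 0" for w w'
      by (smt (verit))
  qed (use lip cost_antimono[of 0 1] L_def in auto)
  then have "\<bar>g x - g y\<bar> \<le> shortcut x y" using assms by (intro shortcut_upper)
  moreover have "g x = 0" "g y > 0" using assms L cost_pos[of 0] by (simp_all add: g_def)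
  ultimately show ?thesis by linarith
qed

lemma Metric_space_shortcut: "Metric_space X shortcut"
proof
  have nn: "0 \<le> shortcut x y" if "x \<in> X" "y \<in> X" for x y
    using shortcut_upper[OF admissible_zero that] by simp
  \<comment> \<open>\<open>Metric_space\<close> asks for nonnegativity and symmetry on the whole
    type, which the default value 0 outside \<open>X\<close> provides.\<close>
  show "0 \<le> shortcut x y" for x y
    using nn[of x y] by (cases "x \<in> X \<and> y \<in> X") (auto simp: shortcut_def)
  show "shortcut x y = shortcut y x" for x y
    by (simp add: shortcut_def abs_minus_commute)
  fix x y assume x: "x \<in> X" and y: "y \<in> X"
  show "shortcut x y = 0 \<longleftrightarrow> x = y"
    using shortcut_pos[OF x y] nn[OF x x] shortcut_le_snowflake[OF x x] x by (cases "x = y") (auto simp: snowflake_def)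
  fix z assume z: "z \<in> X"
  show "shortcut x z \<le> shortcut x y + shortcut y z"
    using shortcut_upper[OF _ x y] shortcut_upper[OF _ y z] by (intro shortcut_least x z) (smt (verit))
qed

text \<open>The truncation of \<open>f - f x\<close> to \<open>[0, r]\<close> is admissible: a pair
  on which \<open>f\<close> is constant, or on which it has already risen by \<open>r\<close>, gets
  equal values.\<close>

lemma shortcut_ge:
  assumes r: "cost (Suc n) \<le> r" "r < cost n"
    and xy: "x \<in> X" "y \<in> X"
    and lip: "\<And>w w'. w \<in> X \<Longrightarrow> w' \<in> X \<Longrightarrow> \<bar>f w - f w'\<bar> \<le> slope r * d w w'"
    and pair: "\<And>p. p \<in> net (Suc n) \<Longrightarrow> f p = f (partner (Suc n) p) \<or>
      f x + r \<le> f p \<and> f x + r \<le> f (partner (Suc n) p)"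
    and large: "f x + r \<le> f y"
  shows "r \<le> shortcut x y"
proof -
  define g where "g w = max 0 (min r (f w - f x))" for w
  have r0: "r > 0" using r cost_pos[of "Suc n"] by linarith
  have "admissible g"
  proof (rule admissibleI[of "Suc n" r])
    show "r \<le> cost m" if "m < Suc n" for m
      using cost_antimono[of m n] that r by simp
    then show "r \<le> cost 0" by simp
    show "\<bar>g w - g w'\<bar> \<le> slope r * d w w'" if "w \<in> X" "w' \<in> X" for w w'
      using lip[OF that] r0 by (auto simp: g_def max_def min_def)
    show "\<bar>g w - g w'\<bar> \<le> r" for w w'
      using r0 by (auto simp: g_def max_def min_def)
    show "\<bar>g p - g (partner (Suc n) p)\<bar> \<le> cost (Suc n)" if "p \<in> net (Suc n)" for p
      using pair[OF that] r0 cost_pos[of "Suc n"] by (auto simp: g_def max_def min_def)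
  qed (rule r(1))
  then have "\<bar>g x - g y\<bar> \<le> shortcut x y" using xy by (intro shortcut_upper)
  moreover have "g x = 0" "g y = r" using r0 large by (auto simp: g_def)
  ultimately show ?thesis using r0 by simp
qed

text \<open>At radii below the net scale at most one pair of the net is within reach of \<open>x\<close>. The witness is
  a truncated distance to \<open>F\<close>, which consists of \<open>x\<close> and that pair.\<close>

lemma shortcut_ge_small:
  assumes r: "cost (Suc n) \<le> r" "r < cost n" and small: "r powr (1 / \<delta>) \<le> radius (Suc n)"
    and x: "x \<in> X"
  obtains F where "F \<subseteq> X" "finite F" "card F \<le> 3"
    "\<And>y. y \<in> X \<Longrightarrow> (\<And>z. z \<in> F \<Longrightarrow> r powr (1 / \<delta>) \<le> d z y) \<Longrightarrow> r \<le> shortcut x y"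
proof -
  define T where "T = r powr (1 / \<delta>)"
  define t where "t = radius (Suc n)"
  define L where "L = slope r"
  have t: "t > 0" "T \<le> t" using small radius_pos[of "Suc n"] by (simp_all add: t_def T_def)
  have r0: "r > 0" using r cost_pos[of "Suc n"] by linarith
  then have T: "T > 0" "L * T = r" "L > 0" by (simp_all add: T_def L_def slope_def)
  let ?N = "net (Suc n)" and ?q = "partner (Suc n)"
  have pq: "p \<in> X" "?q p \<in> X" "d p (?q p) < t" if "p \<in> ?N" for p
    using net(1) partner that unfolding t_def by auto
  have sep: "8 * t \<le> d p p'" if "p \<in> ?N" "p' \<in> ?N" "p \<noteq> p'" for p p'
    using net(2)[of "Suc n"] that unfolding separated_def t_def by auto
  \<comment> \<open>Each pair lies either entirely in \<open>F\<close>, where \<open>f\<close>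
    vanishes, or entirely at distance at least \<open>T\<close> from \<open>F\<close>, where
    \<open>f\<close> is at least \<open>r\<close>.\<close>
  have main: "r \<le> shortcut x y"
    if F: "x \<in> F" "F \<subseteq> X"
      and near: "\<And>p. p \<in> ?N \<Longrightarrow> p \<in> F \<and> ?q p \<in> F \<or> (\<forall>z\<in>F. T \<le> d z p \<and> T \<le> d z (?q p))"
      and y: "y \<in> X" "\<And>z. z \<in> F \<Longrightarrow> T \<le> d z y" for F y
  proof -
    define f where "f w = (INF z\<in>F. L * d z w)" for w
    have F0: "F \<noteq> {}" using F by auto
    have f0: "f z = 0" if "z \<in> F" for z
    proof (rule antisym)
      have "f z \<le> L * d z z"
        unfolding f_def using that T by (intro cINF_lower bdd_belowI[of _ 0]) auto
      then show "f z \<le> 0" using that F by auto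
      show "0 \<le> f z" unfolding f_def using F0 T by (intro cINF_greatest) auto
    qed
    have f_ge: "r \<le> f w" if "\<forall>z\<in>F. T \<le> d z w" for w
    proof -
      have "r \<le> L * d z w" if "z \<in> F" for z
        using \<open>\<forall>z\<in>F. T \<le> d z w\<close> that T by (subst T(2)[symmetric]) auto
      then show ?thesis unfolding f_def using F0 by (intro cINF_greatest)
    qed
    show ?thesis
    proof (rule shortcut_ge[OF r x y(1), of f])
      show "f x + r \<le> f y" using f0 F f_ge y(2) by simp
      show "f p = f (?q p) \<or> f x + r \<le> f p \<and> f x + r \<le> f (?q p)" if "p \<in> ?N" for p
        using near[OF that] f0 f_ge F by auto
      fix w w' assume w: "w \<in> X" "w' \<in> X"
      have "\<bar>(INF z\<in>F. L * d z w) - (INF z\<in>F. L * d z w')\<bar> \<le> L * d w w'"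
      proof (rule abs_INF_diff_le[OF F0 _ _ w])
        fix z w w' assume z: "z \<in> F" and w: "w \<in> X" "w' \<in> X"
        then have "d z w \<le> d z w' + d w w'" using triangle[of z w' w] commute[of w w'] F by auto
        then have "L * d z w \<le> L * (d z w' + d w w')" using T by simp
        then show "L * d z w \<le> L * d z w' + L * d w w'" by (simp add: distrib_left)
      qed (use T in auto)
      then show "\<bar>f w - f w'\<bar> \<le> slope r * d w w'" by (simp add: f_def L_def)
    qed
  qed
  show thesis
  \<comment> \<open>By the separation \<open>8 * t\<close>, at most one net point lies within
    \<open>4 * t\<close> of \<open>x\<close>.\<close>
  proof (cases "\<exists>p\<in>?N. d x p < 4 * t")
    case True
    then obtain p0 where p0: "p0 \<in> ?N" "d x p0 < 4 * t" by blast
    have "r \<le> shortcut x y" if y: "y \<in> X" "\<And>z. z \<in> {x, p0, ?q p0} \<Longrightarrow> T \<le> d z y" for y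
    proof (rule main[OF _ _ _ y])
      show "{x, p0, ?q p0} \<subseteq> X" using x pq p0 by auto
      fix p assume p: "p \<in> ?N"
      show "p \<in> {x, p0, ?q p0} \<and> ?q p \<in> {x, p0, ?q p0} \<or>
        (\<forall>z\<in>{x, p0, ?q p0}. T \<le> d z p \<and> T \<le> d z (?q p))"
      proof (cases "p = p0")
        case False
        have z: "z \<in> X" "d z p0 < 4 * t" if "z \<in> {x, p0, ?q p0}" for z
          using that x pq[OF p0(1)] p0 t commute[of "?q p0" p0] by auto
        \<comment> \<open>Since \<open>z\<close> is within \<open>4 * t\<close> of
          \<open>p0\<close>, it is more than \<open>4 * t\<close> away from \<open>p\<close> and
          more than \<open>3 * t\<close> from the partner of \<open>p\<close>.\<close>
        have "T \<le> d z p \<and> T \<le> d z (?q p)" if "z \<in> {x, p0, ?q p0}" for z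
        proof -
          have "8 * t \<le> d p0 p" using sep p0 p False by auto
          moreover have "d p0 p \<le> d z p0 + d z p"
            using triangle[of p0 z p] commute[of p0 z] z[OF that] pq p p0 by auto
          moreover have "d z p \<le> d z (?q p) + d p (?q p)"
            using triangle[of z "?q p" p] commute[of p "?q p"] z[OF that] pq p by auto
          ultimately show ?thesis using z[OF that] pq(3)[OF p] t by linarith
        qed
        then show ?thesis by blast
      qed simp
    qed simp
    moreover have "{x, p0, ?q p0} \<subseteq> X" using x pq p0 by auto
    moreover have "card {x, p0, ?q p0} \<le> 3"
      by (simp add: card_insert_if)
    ultimately show ?thesis using that[of "{x, p0, ?q p0}"] unfolding T_def by blast
  next
    case False
    have "r \<le> shortcut x y" if y: "y \<in> X" "\<And>z. z \<in> {x} \<Longrightarrow> T \<le> d z y" for y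
    proof (rule main[OF _ _ _ y])
      fix p assume p: "p \<in> ?N"
      have "4 * t \<le> d x p" using False p by auto
      moreover have "d x p \<le> d x (?q p) + d p (?q p)"
        using triangle[of x "?q p" p] commute[of p "?q p"] x pq p by auto
      ultimately show "p \<in> {x} \<and> ?q p \<in> {x} \<or> (\<forall>z\<in>{x}. T \<le> d z p \<and> T \<le> d z (?q p))"
        using t pq(3)[OF p] by auto
    qed (use x in auto)
    then show ?thesis using that[of "{x}"] x unfolding T_def by auto
  qed
qed

text \<open>At radii above the net scale the witness has to take equal values on all pairs of the net: the
  function \<open>L * d p x\<close>, prescribed on both points of each pair, is extended by inf-convolution.\<close>

lemma shortcut_ge_large:
  assumes r: "cost (Suc n) \<le> r" "r < cost n" and large: "radius (Suc n) \<le> r powr (1 / \<delta>)"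
    and xy: "x \<in> X" "y \<in> X" and far: "27 * r powr (1 / \<delta>) \<le> d x y"
  shows "r \<le> shortcut x y"
proof -
  define T where "T = r powr (1 / \<delta>)"
  define t where "t = radius (Suc n)"
  define L where "L = slope r / 2"
  have t: "t > 0" "t \<le> T" using large radius_pos[of "Suc n"] by (simp_all add: t_def T_def)
  have r0: "r > 0" using r cost_pos[of "Suc n"] by linarith
  then have T: "T > 0" "2 * L * T = r" "L > 0" by (simp_all add: T_def L_def slope_def)
  let ?N = "net (Suc n)" and ?q = "partner (Suc n)"
  have pq: "p \<in> X" "?q p \<in> X" "d p (?q p) < t" if "p \<in> ?N" for p
    using net(1) partner that unfolding t_def by auto
  have sep: "8 * t \<le> d p p'" if "p \<in> ?N" "p' \<in> ?N" "p \<noteq> p'" for p p'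
    using net(2)[of "Suc n"] that unfolding separated_def t_def by auto
  obtain p0 where p0: "p0 \<in> ?N" "d p0 x < 8 * t" using net(3)[OF xy(1), of "Suc n"] unfolding t_def by blast
  then have N0: "?N \<noteq> {}" by auto
  define h where "h p w = min (d p w) (d (?q p) w)" for p w
  have h0: "0 \<le> h p w" for p w by (simp add: h_def)
  have h_lip: "h p w \<le> h p w' + d w w'" if "p \<in> ?N" "w \<in> X" "w' \<in> X" for p w w'
    using triangle[of p w' w] triangle[of "?q p" w' w] pq[OF that(1)] that commute[of w w']
    by (auto simp: h_def min_def)
  have h_ge: "d p w - t \<le> h p w" if "p \<in> ?N" "w \<in> X" for p w
    using triangle[of p "?q p" w] pq[OF that(1)] that t by (auto simp: h_def min_def)
  \<comment> \<open>The prescribed values \<open>L * d p x\<close> use half of the allowed slope,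
    the growth away from a pair all of it. The doubling makes up for the size of the pairs: on a
    pair other than that of \<open>p\<close>, belonging to \<open>p'\<close>, \<open>2 * h p\<close>
    is at least \<open>2 * (d p p' - 2 * t)\<close>, which exceeds \<open>d p p'\<close>.\<close>
  define k where "k p w = L * (d p x + 2 * h p w)" for p w
  define f where "f w = (INF p\<in>?N. k p w)" for w
  have k0: "0 \<le> k p w" for p w using T h0[of p w] by (simp add: k_def)
  have f_le: "f w \<le> k p w" if "p \<in> ?N" for p w
    unfolding f_def using that k0 by (intro cINF_lower bdd_belowI[of _ 0]) auto
  have f_ge: "b \<le> f w" if "\<And>p. p \<in> ?N \<Longrightarrow> b \<le> k p w" for b w
    unfolding f_def using N0 that by (intro cINF_greatest)
  have f_pair: "f w = L * d p x" if p: "p \<in> ?N" and w: "w = p \<or> w = ?q p" for p w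
  proof (rule antisym)
    have wX: "w \<in> X" using w pq p by auto
    have "h p w = 0" using w pq[OF p] h0[of p w] by (auto simp: h_def)
    then show "f w \<le> L * d p x" using f_le[OF p, of w] by (simp add: k_def)
    show "L * d p x \<le> f w"
    proof (rule f_ge)
      fix p' assume p': "p' \<in> ?N"
      have "d p x \<le> d p' x + 2 * h p' w"
      proof (cases "p' = p")
        case False
        have "d p' p \<le> d p' w + t"
          using triangle[of p' w p] commute[of w p] w pq[OF p] pq[OF p'] t by auto
        moreover have "8 * t \<le> d p' p" using sep p p' False by auto
        moreover have "d p' w - t \<le> h p' w" using h_ge p' wX by simp
        moreover have "d p x \<le> d p' p + d p' x"
          using triangle[of p p' x] commute[of p p'] pq p p' xy by auto
        ultimately show ?thesis using t by linarith
      qed (use h0 in auto)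
      then show "L * d p x \<le> k p' w" using T by (simp add: k_def)
    qed
  qed
  have "r \<le> shortcut x y"
  proof (rule shortcut_ge[OF r xy, of f])
    show "f p = f (?q p) \<or> f x + r \<le> f p \<and> f x + r \<le> f (?q p)" if "p \<in> ?N" for p
      using f_pair that by simp
    fix w w' assume w: "w \<in> X" "w' \<in> X"
    have "\<bar>(INF p\<in>?N. k p w) - (INF p\<in>?N. k p w')\<bar> \<le> slope r * d w w'"
    proof (rule abs_INF_diff_le[OF N0 _ _ w])
      fix p w w' assume p: "p \<in> ?N" and w: "w \<in> X" "w' \<in> X"
      have "k p w \<le> L * (d p x + 2 * (h p w' + d w w'))"
        using h_lip[OF p w] T by (simp add: k_def)
      also have "\<dots> = k p w' + slope r * d w w'" by (simp add: k_def L_def algebra_simps)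
      finally show "k p w \<le> k p w' + slope r * d w w'" .
    qed (rule k0)
    then show "\<bar>f w - f w'\<bar> \<le> slope r * d w w'" by (simp add: f_def)
  next
    \<comment> \<open>Origin of 27: the nearest pair gives \<open>f x \<le> 3 * L * (8 * T)\<close>,
      the required rise is \<open>r = 2 * L * T\<close>, and the size of a pair costs one more
      \<open>T\<close>.\<close>
    have "h p0 x \<le> d p0 x" by (simp add: h_def)
    then have "k p0 x \<le> L * (24 * t)"
      using p0 T unfolding k_def by (intro mult_left_mono) auto
    then have fx: "f x \<le> L * (24 * T)"
      using f_le[OF p0(1), of x] t T by (smt (verit) mult_left_mono)
    have "L * (26 * T) \<le> f y"
    proof (rule f_ge)
      fix p assume p: "p \<in> ?N"
      have "d x y \<le> d p x + d p y" using triangle[of x p y] commute[of x p] pq p xy by auto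
      then have "26 * T \<le> d p x + 2 * h p y"
        using h_ge[OF p xy(2)] h0[of p y] far t unfolding T_def[symmetric] by linarith
      then show "L * (26 * T) \<le> k p y" unfolding k_def using T by (intro mult_left_mono) auto
    qed
    then show "f x + r \<le> f y" using fx T by (simp add: algebra_simps)
  qed
  then show ?thesis .
qed

section \<open>Ahlfors regularity of the shortcut distance\<close>

definition ball_const :: real where
  "ball_const = C * (3 + 27 powr Q)"

lemma ball_const_pos: "ball_const > 0"
  using C by (simp add: ball_const_def add_pos_pos)

lemma cost_0_root: "r < cost 0 \<Longrightarrow> 0 < r \<Longrightarrow> r powr (1 / \<delta>) < R / 100"
proof -
  assume "r < cost 0" "0 < r"
  then have "r powr (1 / \<delta>) < cost 0 powr (1 / \<delta>)" using \<delta> by (intro powr_less_mono2) auto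
  then show ?thesis using cost_root_le[of 0] R by simp
qed

sublocale shortcut: Metric_space X shortcut
  by (rule Metric_space_shortcut)

text \<open>With \<open>n\<close> such that \<open>cost (Suc n) \<le> r < cost n\<close>, the
  shortcut ball lies in at most three \<open>d\<close>-balls of radius \<open>T\<close> if
  \<open>T\<close> is at most the net scale, and in one of radius \<open>27 * T\<close> otherwise.
  \<open>ball_const\<close> adds up both cases.\<close>

lemma measure_shortcut_ball_le:
  assumes x: "x \<in> X" and r: "0 < r" "r < cost 0"
  shows "\<mu> (shortcut.mball x r) \<le> ennreal (ball_const * r powr (Q / \<delta>))"
proof -
  define T where "T = r powr (1 / \<delta>)"
  have T: "0 < T" "T < R / 100" "T powr Q = r powr (Q / \<delta>)"
    using r cost_0_root by (simp_all add: T_def powr_powr)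
  define m where "m = (LEAST m. cost m \<le> r)"
  have m: "cost m \<le> r" unfolding m_def using ex_cost_le[OF r(1)] by (rule LeastI_ex)
  then have "m \<noteq> 0" using r(2) by (metis not_le)
  then obtain n where n: "m = Suc n" using not0_implies_Suc by blast
  then have "\<not> cost n \<le> r" unfolding m_def using not_less_Least by (metis lessI)
  with m n have nr: "cost (Suc n) \<le> r" "r < cost n" by auto
  show ?thesis
  proof (cases "T \<le> radius (Suc n)")
    case True
    obtain F where F: "F \<subseteq> X" "finite F" "card F \<le> 3"
      and ge: "\<And>y. y \<in> X \<Longrightarrow> (\<And>z. z \<in> F \<Longrightarrow> T \<le> d z y) \<Longrightarrow> r \<le> shortcut x y"
      using shortcut_ge_small[OF nr _ x] True unfolding T_def by blast
    have "shortcut.mball x r \<subseteq> (\<Union>z\<in>F. mball z T)"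
    proof
      fix y assume "y \<in> shortcut.mball x r"
      then have y: "y \<in> X" "shortcut x y < r" by auto
      then obtain z where "z \<in> F" "d z y < T" using ge[of y] by (meson not_less)
      then show "y \<in> (\<Union>z\<in>F. mball z T)" using y F by auto
    qed
    then have "\<mu> (shortcut.mball x r) \<le> \<mu> (\<Union>z\<in>F. mball z T)" by (rule hausdorff_measure_mono)
    also have "\<dots> \<le> (\<Sum>z\<in>F. \<mu> (mball z T))" by (rule hausdorff_measure_finite_UN_le[OF F(2)])
    also have "\<dots> \<le> (\<Sum>z\<in>F. ennreal (C * T powr Q))"
      using F T R by (intro sum_mono ball_upper) auto
    also have "\<dots> = ennreal (real (card F) * (C * T powr Q))"
      using C by (simp add: ennreal_mult ennreal_of_nat_eq_real_of_nat)
    also have "\<dots> \<le> ennreal (ball_const * r powr (Q / \<delta>))"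
    proof (rule ennreal_leI)
      have "real (card F) * (C * T powr Q) \<le> (3 + 27 powr Q) * (C * T powr Q)"
        using F(3) C by (intro mult_right_mono) (auto intro: add_increasing2)
      then show "real (card F) * (C * T powr Q) \<le> ball_const * r powr (Q / \<delta>)"
        by (simp add: ball_const_def T(3) mult_ac)
    qed
    finally show ?thesis .
  next
    case False
    have "shortcut.mball x r \<subseteq> mball x (27 * T)"
      using shortcut_ge_large[OF nr _ x] False unfolding T_def by (force simp: not_le)
    then have "\<mu> (shortcut.mball x r) \<le> \<mu> (mball x (27 * T))" by (rule hausdorff_measure_mono)
    also have "\<dots> \<le> ennreal (C * (27 * T) powr Q)"
      using x T R by (intro ball_upper) auto
    also have "\<dots> \<le> ennreal (ball_const * r powr (Q / \<delta>))"
      using C T by (intro ennreal_leI) (simp add: ball_const_def powr_mult distrib_left distrib_right)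
    finally show ?thesis .
  qed
qed

text \<open>Above, the measure for \<open>shortcut\<close> is at most that of the snowflake, which
  is \<open>\<mu>\<close> and is bounded on shortcut balls. Below, the same bound on
  \<open>\<mu>\<close> feeds the mass distribution principle, as a shortcut ball contains the
  snowflake ball of equal radius.\<close>

lemma ahlfors_regular_shortcut: "ahlfors_regular X shortcut (Q / \<delta>)"
proof -
  define s where "s = Q / \<delta>"
  have s: "s > 0" using Q \<delta> by (simp add: s_def)
  define M where "M = ball_const"
  have M: "M > 0" by (simp add: M_def ball_const_pos)
  have two: "1 \<le> 2 powr s" using s by (simp add: ge_one_powr_ge_zero)
  let ?H = "hausdorff_measure X shortcut s"
  have diam: "diam_wrt shortcut X \<le> ennreal (cost 0)"
    unfolding diam_wrt_le_iff using shortcut_le_cost_0 by (auto intro: ennreal_leI)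
  have C1: "1 \<le> M * 2 powr s * C"
  proof -
    have "1 * 1 \<le> C * (3 + 27 powr Q)" using C by (intro mult_mono) auto
    then have "1 * 1 * 1 \<le> M * 2 powr s * C"
      unfolding M_def ball_const_def using two C by (intro mult_mono) auto
    then show ?thesis by simp
  qed
  show ?thesis
    unfolding ahlfors_regular_def s_def[symmetric]
  proof (intro conjI Metric_space_shortcut exI[of _ "M * 2 powr s * C"] C1 ballI allI impI)
    fix x r assume x: "x \<in> X" and r: "r > 0" and "ennreal r < diam_wrt shortcut X / 2"
    then have "ennreal (2 * r) < diam_wrt shortcut X" using less_half_ennreal_iff by simp
    then have "ennreal (2 * r) < ennreal (cost 0)" using diam by (rule order_less_le_trans)
    then have r': "r < cost 0" using r by (simp add: ennreal_less_iff)
    define T where "T = r powr (1 / \<delta>)"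
    have T: "0 < T" "T < R" "T powr Q = r powr s"
      using r cost_0_root[OF r' r] R by (simp_all add: T_def s_def powr_powr)
    let ?B = "shortcut.mball x r"
    have "mball x T \<subseteq> ?B"
    proof
      fix y assume "y \<in> mball x T"
      then have y: "y \<in> X" "d x y < T" by auto
      then have "snowflake d \<delta> x y < r"
        using powr_less_powr_inverse_iff[OF \<delta>(1), of "d x y" r] r by (simp add: snowflake_def T_def)
      then show "y \<in> ?B" using shortcut_le_snowflake[OF x y(1)] x y by auto
    qed
    have "ennreal (1 / (M * 2 powr s * C) * r powr s) = ennreal (1 / (M * 2 powr s)) * ennreal (1 / C * T powr Q)"
      using M C by (simp add: T ennreal_mult[symmetric])
    also have "\<dots> \<le> ennreal (1 / (M * 2 powr s)) * \<mu> (mball x T)"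
      by (intro mult_left_mono ball_lower x T) auto
    also have "\<dots> \<le> ennreal (1 / (M * 2 powr s)) * \<mu> ?B"
      by (intro mult_left_mono hausdorff_measure_mono \<open>mball x T \<subseteq> ?B\<close>) auto
    also have "\<dots> \<le> ?H ?B"
      using measure_shortcut_ball_le M cost_pos[of 0]
      by (intro hausdorff_measure_mass_distribution[of X shortcut d M "cost 0"] Metric_space_shortcut)
         (auto simp: M_def s_def)
    finally show "ennreal (1 / (M * 2 powr s * C) * r powr s) \<le> ?H ?B" .
    have "?H ?B \<le> hausdorff_measure X (snowflake d \<delta>) s ?B"
      using shortcut_le_snowflake s by (intro hausdorff_measure_mono_dist) auto
    also have "\<dots> = \<mu> ?B"
      unfolding s_def by (rule hausdorff_measure_snowflake[OF Metric_space_axioms \<delta>(1)])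
    also have "\<dots> \<le> ennreal (M * r powr s)"
      unfolding M_def s_def by (rule measure_shortcut_ball_le[OF x r r'])
    also have "\<dots> \<le> ennreal (M * 2 powr s * C * r powr s)"
    proof (intro ennreal_leI mult_right_mono)
      have "M * (1 * 1) \<le> M * (2 powr s * C)" using M two C by (intro mult_left_mono mult_mono) auto
      then show "M \<le> M * 2 powr s * C" by (simp add: mult.assoc)
    qed simp
    finally show "?H ?B \<le> ennreal (M * 2 powr s * C * r powr s)" .
  qed
qed

section \<open>Sets of biLipschitz equivalence are porous, hence null\<close>

lemma bilipschitz_imp_porous:
  assumes A: "A \<subseteq> X" and L: "bilipschitz_equivalent_on A shortcut (snowflake d \<delta>)"
  obtains \<eta> where "0 < \<eta>" "\<eta> \<le> 1"
    "\<And>u. u > 0 \<Longrightarrow> \<exists>t>0. t < u \<and> (\<forall>a\<in>A. \<exists>w\<in>X. d a w \<le> 9 * t \<and> mball w (\<eta> * t) \<inter> A = {})"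
proof -
  obtain L where L: "L \<ge> 1" and bil: "\<And>p q. p \<in> A \<Longrightarrow> q \<in> A \<Longrightarrow> 1 / L * snowflake d \<delta> p q \<le> shortcut p q"
    using L unfolding bilipschitz_equivalent_on_def by blast
  define b where "b = (lam / 2) powr \<delta>"
  have b: "b > 0" using lam_pos by (simp add: b_def)
  \<comment> \<open>The first bound keeps points of the two balls at distance at least
    \<open>lam / 2 * t\<close>; the second gives
    \<open>2 * \<eta> powr \<delta> \<le> b / (4 * L)\<close>.\<close>
  define \<eta> where "\<eta> = min (lam / 4) ((b / (8 * L)) powr (1 / \<delta>))"
  have \<eta>: "0 < \<eta>" "\<eta> \<le> lam / 4" "\<eta> \<le> 1"
    using lam_pos lam_less_1 b L by (auto simp: \<eta>_def)
  have "\<eta> powr \<delta> \<le> b / (8 * L)"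
    using powr_le_powr_inverse_iff[OF \<delta>(1), of \<eta> "b / (8 * L)"] \<eta> b L by (simp add: \<eta>_def)
  then have \<eta>\<delta>: "2 * \<eta> powr \<delta> \<le> b / (4 * L)" using L by (simp add: field_simps)
  show thesis
  proof (rule that[OF \<eta>(1,3)])
    fix u :: real assume u: "u > 0"
    have "0 < b / (4 * L)" using b L by simp
    then have "\<forall>\<^sub>F n in sequentially. radius n < u \<and> eps n < b / (4 * L)"
      using order_tendstoD(2)[OF radius_tendsto u] order_tendstoD(2)[OF eps_tendsto] eventually_conj by blast
    then obtain n where n: "radius n < u" "eps n < b / (4 * L)"
      using eventually_happens' sequentially_bot by blast
    let ?t = "radius n"
    have t: "?t > 0" by (rule radius_pos)
    have "\<exists>w\<in>X. d a w \<le> 9 * ?t \<and> mball w (\<eta> * ?t) \<inter> A = {}" if a: "a \<in> A" for a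
    proof -
      have aX: "a \<in> X" using a A by blast
      obtain p where p: "p \<in> net n" "d p a < 8 * ?t" using net(3)[OF aX] by blast
      define q where "q = partner n p"
      have pq: "p \<in> X" "q \<in> X" "lam * ?t \<le> d p q" "d p q < ?t"
        using net(1) partner p unfolding q_def by auto
      have "d a p \<le> 9 * ?t" "d a q \<le> 9 * ?t"
        using triangle[of a p q] commute[of a p] pq p aX t by auto
      \<comment> \<open>If \<open>A\<close> met both balls, the two points found would have
        snowflaked distance at least \<open>?t powr \<delta> * b\<close>, while the route through
        the shortcut is shorter than \<open>1 / L\<close> times that.\<close>
      moreover have "mball p (\<eta> * ?t) \<inter> A = {} \<or> mball q (\<eta> * ?t) \<inter> A = {}"
      proof (rule ccontr)
        assume "\<not> ?thesis"
        then obtain a1 a2 where a1: "a1 \<in> A" "a1 \<in> X" "d p a1 < \<eta> * ?t" and a2: "a2 \<in> A" "a2 \<in> X" "d q a2 < \<eta> * ?t"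
          by auto
        have small: "shortcut z a' \<le> ?t powr \<delta> * \<eta> powr \<delta>" if "z \<in> X" "a' \<in> X" "d z a' < \<eta> * ?t" for z a'
        proof -
          have "shortcut z a' \<le> d z a' powr \<delta>"
            using shortcut_le_snowflake[OF that(1,2)] by (simp add: snowflake_def)
          also have "\<dots> \<le> (\<eta> * ?t) powr \<delta>" using that \<delta> by (intro powr_mono2) auto
          finally show ?thesis by (simp add: powr_mult mult.commute)
        qed
        have "shortcut a1 a2 \<le> shortcut p a1 + shortcut p q + shortcut q a2"
          using shortcut.triangle[of a1 p a2] shortcut.triangle[of p q a2] shortcut.commute[of a1 p] a1 a2 pq by auto
        also have "\<dots> \<le> ?t powr \<delta> * \<eta> powr \<delta> + ?t powr \<delta> * eps n + ?t powr \<delta> * \<eta> powr \<delta>"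
          using small[OF pq(1) a1(2,3)] small[OF pq(2) a2(2,3)] shortcut_partner_le[OF p(1)]
          by (simp add: q_def cost_def mult.commute)
        also have "\<dots> = ?t powr \<delta> * (2 * \<eta> powr \<delta> + eps n)" by (simp add: algebra_simps)
        also have "\<dots> < ?t powr \<delta> * (b / (4 * L) + b / (4 * L))"
          using \<eta>\<delta> n(2) t by (intro mult_strict_left_mono) auto
        also have "\<dots> \<le> 1 / L * (?t powr \<delta> * b)" using L b t by (simp add: field_simps)
        also have "?t powr \<delta> * b = (lam / 2 * ?t) powr \<delta>"
          unfolding b_def powr_mult by (rule mult.commute)
        also have "1 / L * (lam / 2 * ?t) powr \<delta> \<le> 1 / L * snowflake d \<delta> a1 a2"
        proof (intro mult_left_mono)
          have "d p q \<le> d p a1 + d a1 a2 + d q a2"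
            using triangle[of p a1 q] triangle[of a1 a2 q] commute[of a2 q] a1 a2 pq by auto
          moreover have "\<eta> * ?t \<le> lam / 4 * ?t" using \<eta> t by (intro mult_right_mono) auto
          ultimately have "lam / 2 * ?t \<le> d a1 a2" using pq a1 a2 by linarith
          then show "(lam / 2 * ?t) powr \<delta> \<le> snowflake d \<delta> a1 a2"
            unfolding snowflake_def using lam_pos t \<delta> by (intro powr_mono2) auto
        qed (use L in auto)
        also have "\<dots> \<le> shortcut a1 a2" by (rule bil[OF a1(1) a2(1)])
        finally show False by simp
      qed
      ultimately show ?thesis using pq by blast
    qed
    then show "\<exists>t>0. t < u \<and> (\<forall>a\<in>A. \<exists>w\<in>X. d a w \<le> 9 * t \<and> mball w (\<eta> * t) \<inter> A = {})"
      using n(1) t by blast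
  qed
qed

text \<open>Separability covers \<open>A\<close> by countably many balls of radius
  \<open>R / 2\<close>, in each of which \<open>porous_null_set\<close> applies; the holes of
  \<open>A\<close> are also holes of its subsets.\<close>

lemma bilipschitz_null_set:
  assumes A: "A \<subseteq> X" and sep: "separable_space (subtopology mtopology A)"
    and L: "bilipschitz_equivalent_on A shortcut (snowflake d \<delta>)"
  shows "\<mu> A = 0"
proof (cases "A = {}")
  case False
  obtain D where D: "countable D" "D \<subseteq> A" "subtopology mtopology A closure_of D = A"
    using sep A unfolding separable_space_def by (auto simp: Int_absorb1)
  have near: "\<exists>z\<in>D. a \<in> mball z (R/2)" if a: "a \<in> A" for a
  proof -
    have "a \<in> mtopology closure_of (A \<inter> D)" using D(3) a by (auto simp: closure_of_subtopology)
    then obtain z where "z \<in> D" "z \<in> mball a (R/2)"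
      using half_gt_zero[OF R] unfolding metric_closure_of by blast
    then show ?thesis by (auto simp: commute)
  qed
  then have "D \<noteq> {}" using False by blast
  then obtain e :: "nat \<Rightarrow> 'a" where e: "range e = D" using D(1) uncountable_def by blast
  have "A \<subseteq> (\<Union>k. A \<inter> mball (e k) (R/2))"
    using near e by blast
  then have "\<mu> A \<le> \<mu> (\<Union>k. A \<inter> mball (e k) (R/2))" by (rule hausdorff_measure_mono)
  also have "\<dots> \<le> (\<Sum>k. \<mu> (A \<inter> mball (e k) (R/2)))" by (rule hausdorff_measure_countable_subadditive)
  also have "(\<lambda>k. \<mu> (A \<inter> mball (e k) (R/2))) = (\<lambda>_. 0)"
  proof
    fix k
    obtain \<eta> where \<eta>: "0 < \<eta>" "\<eta> \<le> 1" and porous: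
      "\<And>u. u > 0 \<Longrightarrow> \<exists>t>0. t < u \<and> (\<forall>a\<in>A. \<exists>w\<in>X. d a w \<le> 9 * t \<and> mball w (\<eta> * t) \<inter> A = {})"
      using bilipschitz_imp_porous[OF A L] by blast
    show "\<mu> (A \<inter> mball (e k) (R/2)) = 0"
    proof (rule porous_null_set[OF _ \<eta>])
      fix u :: real assume "u > 0"
      then show "\<exists>t>0. t < u \<and> (\<forall>a\<in>A \<inter> mball (e k) (R/2). \<exists>w\<in>X. d a w \<le> 9 * t \<and>
          mball w (\<eta> * t) \<inter> (A \<inter> mball (e k) (R/2)) = {})"
        using porous[of u] by (metis IntD1 inf_assoc inf_bot_left)
    qed auto
  qed
  finally show ?thesis by simp
qed simp

end

section \<open>The ball condition for snowflakes\<close>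

lemma regular_spaceI:
  assumes "Metric_space X d" "Q > 0" "C \<ge> 1" "R > 0" and R: "ennreal R \<le> diam_wrt d X / 2"
    and ball: "\<And>x r. x \<in> X \<Longrightarrow> r > 0 \<Longrightarrow> ennreal r < diam_wrt d X / 2 \<Longrightarrow>
      ennreal (1 / C * r powr Q) \<le> hausdorff_measure X d Q (Metric_space.mball X d x r) \<and>
      hausdorff_measure X d Q (Metric_space.mball X d x r) \<le> ennreal (C * r powr Q)"
  shows "regular_space X d Q C R"
proof -
  have "ennreal r < diam_wrt d X / 2" if "0 < r" "r < R" for r
    using R that by (intro order_less_le_trans[OF ennreal_lessI]) auto
  then show ?thesis
    unfolding regular_space_def regular_space_axioms_def using assms by blast
qed

text \<open>The second point may be taken so close to the centre \<open>p\<close> that the error in the triangle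
  inequality through it is absorbed by the strict concavity of the snowflaking function.\<close>

lemma snowflake_le_through_near_points:
  assumes d: "Metric_space X d" and \<delta>: "0 < \<delta>" "\<delta> < 1"
    and in_X: "p \<in> X" "q \<in> X" "p1 \<in> X" "p2 \<in> X"
    and far: "T \<le> d p p1" "T \<le> d p p2" and q: "2 * d p q \<le> (2 powr (1 - \<delta>) - 1) * T" and T: "T > 0"
  shows "snowflake d \<delta> p1 p2 \<le> snowflake d \<delta> p1 p + snowflake d \<delta> p2 q"
proof -
  interpret Metric_space X d by fact
  define \<kappa> where "\<kappa> = (2::real) powr (1 - \<delta>)"
  have \<kappa>: "1 \<le> \<kappa>" "\<kappa> \<le> 2"
    using \<delta> powr_mono[of "1 - \<delta>" 1 "2::real"] unfolding \<kappa>_def by (auto intro!: ge_one_powr_ge_zero)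
  define a b where "a = d p1 p" and "b = d p2 q"
  have "(\<kappa> - 1) * T \<le> 1 * T" using \<kappa> T by (intro mult_right_mono) auto
  then have dq: "2 * d p q \<le> T" using q by (simp add: \<kappa>_def)
  have a: "T \<le> a" using far commute by (simp add: a_def)
  have "d p p2 \<le> d p q + b" using triangle[of p q p2] in_X commute[of q p2] by (simp add: b_def)
  then have b: "T / 2 \<le> b" using far dq by linarith
  define m M where "m = min a b" and "M = max a b"
  have m: "0 < m" "m \<le> M" "T / 2 \<le> m" using a b T by (auto simp: m_def M_def)
  have "d p1 p2 \<le> a + d p q + b"
    using triangle[of p1 p p2] triangle[of p q p2] in_X commute[of q p2] by (simp add: a_def b_def)
  \<comment> \<open>The detour is absorbed by the surplus that \<open>add_powr_strict_bound\<close>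
    grants to the smaller leg \<open>m \<ge> T / 2\<close>.\<close>
  also have "d p q \<le> (\<kappa> - 1) * (T / 2)" using q by (simp add: \<kappa>_def)
  also have "\<dots> \<le> (\<kappa> - 1) * m" using \<kappa> m by (intro mult_left_mono) auto
  also have "a + (\<kappa> - 1) * m + b = M + \<kappa> * m" by (auto simp: m_def M_def min_def max_def algebra_simps)
  finally have "d p1 p2 powr \<delta> \<le> (M + \<kappa> * m) powr \<delta>" using \<delta> by (intro powr_mono2) auto
  also have "\<dots> \<le> M powr \<delta> + m powr \<delta>"
    unfolding \<kappa>_def by (rule add_powr_strict_bound[OF \<delta> m(1,2)])
  also have "\<dots> = a powr \<delta> + b powr \<delta>" by (auto simp: m_def M_def min_def max_def)
  finally show ?thesis by (simp add: snowflake_def a_def b_def)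
qed

text \<open>Take \<open>q1 = p\<close> and \<open>q2\<close> in an annulus around \<open>p\<close>
  of outer radius \<open>\<theta> * T\<close>: close enough for
  \<open>snowflake_le_through_near_points\<close>, yet at distance comparable to
  \<open>T\<close>.\<close>

lemma snowflake_ball_condition:
  assumes reg: "ahlfors_regular X d Q" "Q > 0" and \<delta>: "0 < \<delta>" "\<delta> < 1"
  shows "\<exists>l::real. 0 < l \<and> l < 1 \<and>
          (\<forall>p\<in>X. \<forall>r>0. ennreal r < diam_wrt (snowflake d \<delta>) X \<longrightarrow>
            (\<exists>q1\<in>Metric_space.mball X (snowflake d \<delta>) p r.
             \<exists>q2\<in>Metric_space.mball X (snowflake d \<delta>) p r.
               snowflake d \<delta> q1 q2 \<ge> l * r \<and>
               (\<forall>p1\<in>X - Metric_space.mball X (snowflake d \<delta>) p r.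
                \<forall>p2\<in>X - Metric_space.mball X (snowflake d \<delta>) p r.
                  snowflake d \<delta> p1 p2 \<le> snowflake d \<delta> p1 q1 + snowflake d \<delta> p2 q2)))"
proof -
  have d: "Metric_space X d" using reg by (simp add: ahlfors_regular_def)
  interpret Metric_space X d by (rule d)
  obtain C where C: "C \<ge> 1" and ball: "\<And>x r. x \<in> X \<Longrightarrow> r > 0 \<Longrightarrow> ennreal r < diam_wrt d X / 2 \<Longrightarrow>
        ennreal (1 / C * r powr Q) \<le> hausdorff_measure X d Q (mball x r) \<and>
        hausdorff_measure X d Q (mball x r) \<le> ennreal (C * r powr Q)"
    using reg unfolding ahlfors_regular_def by blast
  define \<theta> where "\<theta> = ((2::real) powr (1 - \<delta>) - 1) / 2"
  have "1 < (2::real) powr (1 - \<delta>)" "(2::real) powr (1 - \<delta>) < 2"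
    using \<delta> powr_less_mono[of "1 - \<delta>" 1 "2::real"] gr_one_powr[of 2 "1 - \<delta>"] by auto
  then have \<theta>: "0 < \<theta>" "\<theta> < 1/2" by (auto simp: \<theta>_def)
  show ?thesis
  proof (cases "\<exists>R>0. ennreal R \<le> diam_wrt d X / 2")
    \<comment> \<open>The diameter is 0 here, so no radius qualifies and \<open>1/2\<close> is an
      arbitrary choice.\<close>
    case False
    have "\<not> ennreal r < diam_wrt (snowflake d \<delta>) X" if "r > 0" for r
    proof
      assume "ennreal r < diam_wrt (snowflake d \<delta>) X"
      then have "ennreal (r powr (1 / \<delta>)) < diam_wrt d X"
        using less_diam_snowflake_iff[OF d \<delta>(1), of r] that by simp
      then have "ennreal (r powr (1 / \<delta>) / 2) \<le> diam_wrt d X / 2"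
        using less_half_ennreal_iff[of "r powr (1 / \<delta>) / 2" "diam_wrt d X"] by simp
      then show False using False that by (metis half_gt_zero powr_gt_zero less_irrefl)
    qed
    then show ?thesis by (intro exI[of _ "1/2"]) auto
  next
    case True
    then obtain R0 where R0: "R0 > 0" "ennreal R0 \<le> diam_wrt d X / 2" by blast
    interpret R0: regular_space X d Q C R0
      by (rule regular_spaceI[OF d reg(2) C R0 ball])
    have lam: "0 < R0.lam" "R0.lam < 1" by (rule R0.lam_pos R0.lam_less_1)+
    have l\<theta>: "0 < R0.lam * \<theta>" "R0.lam * \<theta> < 1"
      using lam \<theta> mult_strict_mono[of R0.lam 1 \<theta> 1] by auto
    show ?thesis
    proof (intro exI[of _ "(R0.lam * \<theta>) powr \<delta>"] conjI ballI allI impI)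
      show "0 < (R0.lam * \<theta>) powr \<delta>" using lam \<theta> by simp
      show "(R0.lam * \<theta>) powr \<delta> < 1" using l\<theta> \<delta> powr_less_mono2[of \<delta> "R0.lam * \<theta>" 1] by simp
      fix p r assume p: "p \<in> X" and r: "r > 0" and lt: "ennreal r < diam_wrt (snowflake d \<delta>) X"
      define T where "T = r powr (1 / \<delta>)"
      have T: "T > 0" "T powr \<delta> = r" using r \<delta> by (simp_all add: T_def powr_powr)
      have "ennreal T < diam_wrt d X"
        unfolding T_def using lt less_diam_snowflake_iff[OF d \<delta>(1), of r] r by simp
      then have half: "ennreal (T / 2) < diam_wrt d X / 2"
        using less_half_ennreal_iff[of "T / 2" "diam_wrt d X"] T by simp
      \<comment> \<open>\<open>lam\<close> depends only on \<open>C\<close> and \<open>Q\<close>, so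
        the constant at radius \<open>T / 2\<close> is the one from \<open>R0\<close>, uniformly in
        \<open>p\<close> and \<open>r\<close>.\<close>
      interpret R: regular_space X d Q C "T / 2"
        by (rule regular_spaceI[OF d reg(2) C _ less_imp_le[OF half] ball]) (use T in auto)
      have "\<theta> * T < T / 2" using \<theta> T by simp
      then obtain q where q: "q \<in> X" "R.lam * (\<theta> * T) \<le> d p q" "d p q < \<theta> * T"
        using R.ex_point_in_annulus[OF p, of "\<theta> * T"] \<theta> T by auto
      note ball_eq = mball_snowflake[OF d \<delta> less_imp_le[OF r], folded T_def]
      show "\<exists>q1\<in>Metric_space.mball X (snowflake d \<delta>) p r.
             \<exists>q2\<in>Metric_space.mball X (snowflake d \<delta>) p r.
               snowflake d \<delta> q1 q2 \<ge> (R0.lam * \<theta>) powr \<delta> * r \<and>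
               (\<forall>p1\<in>X - Metric_space.mball X (snowflake d \<delta>) p r.
                \<forall>p2\<in>X - Metric_space.mball X (snowflake d \<delta>) p r.
                  snowflake d \<delta> p1 p2 \<le> snowflake d \<delta> p1 q1 + snowflake d \<delta> p2 q2)"
      proof (rule bexI[of _ p], rule bexI[of _ q], intro conjI ballI)
        show "p \<in> Metric_space.mball X (snowflake d \<delta>) p r" using p T by (simp add: ball_eq)
        have "d p q < T" using q(3) \<open>\<theta> * T < T / 2\<close> T by linarith
        then show "q \<in> Metric_space.mball X (snowflake d \<delta>) p r" using p q by (simp add: ball_eq)
        have "(R0.lam * \<theta>) powr \<delta> * r = (R0.lam * (\<theta> * T)) powr \<delta>"
          unfolding T(2)[symmetric] powr_mult by simp
        also have "\<dots> \<le> d p q powr \<delta>"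
          using q(2) lam \<theta> T \<delta> by (intro powr_mono2) auto
        finally show "(R0.lam * \<theta>) powr \<delta> * r \<le> snowflake d \<delta> p q" by (simp add: snowflake_def)
        fix p1 p2 assume p12: "p1 \<in> X - Metric_space.mball X (snowflake d \<delta>) p r"
          "p2 \<in> X - Metric_space.mball X (snowflake d \<delta>) p r"
        have "2 * d p q \<le> (2 powr (1 - \<delta>) - 1) * T" using q(3) by (simp add: \<theta>_def)
        then show "snowflake d \<delta> p1 p2 \<le> snowflake d \<delta> p1 p + snowflake d \<delta> p2 q"
          using p12 p q T by (intro snowflake_le_through_near_points[OF d \<delta>, of _ _ _ _ T]) (auto simp: ball_eq)
      qed
    qed
  qed
qed

section \<open>Existence of the distance and conclusion\<close>

lemma ex_shortcut_distance:
  assumes reg: "ahlfors_regular X d Q" "Q > 0" and \<delta>: "0 < \<delta>" "\<delta> < 1"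
  shows "\<exists>d' :: 'a \<Rightarrow> 'a \<Rightarrow> real.
          Metric_space X d' \<and>
          (\<forall>p\<in>X. \<forall>q\<in>X. d' p q \<le> snowflake d \<delta> p q) \<and>
          ahlfors_regular X d' (Q / \<delta>) \<and>
          (\<forall>A\<subseteq>X. separable_space (subtopology (Metric_space.mtopology X d) A) \<longrightarrow>
             hausdorff_measure X (snowflake d \<delta>) (Q / \<delta>) A > 0 \<longrightarrow>
             \<not> bilipschitz_equivalent_on A d' (snowflake d \<delta>))"
proof -
  have d: "Metric_space X d" using reg by (simp add: ahlfors_regular_def)
  interpret Metric_space X d by (rule d)
  obtain C where C: "C \<ge> 1" and ball: "\<And>x r. x \<in> X \<Longrightarrow> r > 0 \<Longrightarrow> ennreal r < diam_wrt d X / 2 \<Longrightarrow>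
        ennreal (1 / C * r powr Q) \<le> hausdorff_measure X d Q (mball x r) \<and>
        hausdorff_measure X d Q (mball x r) \<le> ennreal (C * r powr Q)"
    using reg unfolding ahlfors_regular_def by blast
  show ?thesis
  proof (cases "\<exists>x\<in>X. \<exists>y\<in>X. x \<noteq> y")
    case True
    then obtain x y where xy: "x \<in> X" "y \<in> X" "x \<noteq> y" by blast
    \<comment> \<open>A finite radius up to half the diameter, also when \<open>X\<close> is
      unbounded.\<close>
    define R where "R = d x y / 2"
    have R: "R > 0" using xy by (simp add: R_def)
    have "ennreal R = ennreal (d x y) / 2" using divide_ennreal[of "d x y" 2] by (simp add: R_def)
    also have "\<dots> \<le> diam_wrt d X / 2"
      by (intro divide_right_mono_ennreal diam_wrt_upper xy)
    finally have "regular_space X d Q C R" by (rule regular_spaceI[OF d reg(2) C R _ ball])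
    then interpret snowflake_space X d Q C R \<delta>
      using \<delta> by (simp add: snowflake_space_def snowflake_space_axioms_def)
    have "\<not> bilipschitz_equivalent_on A shortcut (snowflake d \<delta>)"
      if "A \<subseteq> X" "separable_space (subtopology mtopology A)"
        "hausdorff_measure X (snowflake d \<delta>) (Q / \<delta>) A > 0" for A
      using bilipschitz_null_set[OF that(1,2)] that(3) hausdorff_measure_snowflake[OF d \<delta>(1), of Q A] by auto
    then show ?thesis
      using Metric_space_shortcut shortcut_le_snowflake ahlfors_regular_shortcut
      by (intro exI[of _ shortcut]) auto
  next
    \<comment> \<open>With at most one point all sets are null, so the snowflake itself
      serves.\<close>
    case False
    have null: "hausdorff_measure X (snowflake d \<delta>) (Q / \<delta>) A = 0" if "A \<subseteq> X" for A
    proof (cases "A = {}")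
      case False
      then obtain x where "x \<in> A" by blast
      then have "A = {x}" "x \<in> X" using that \<open>\<not> (\<exists>x\<in>X. \<exists>y\<in>X. x \<noteq> y)\<close> by blast+
      then show ?thesis by (simp add: hausdorff_measure_singleton snowflake_def)
    qed simp
    show ?thesis
      using Metric_space_snowflake[OF d \<delta>] ahlfors_regular_snowflake[OF reg(1) \<delta>] null
      by (intro exI[of _ "snowflake d \<delta>"]) auto
  qed
qed

theorem theorem4p1:
  fixes X :: "'a set" and d :: "'a \<Rightarrow> 'a \<Rightarrow> real" and Q \<delta> :: real
  assumes "Metric_space X d"
    and "Q > 0"
    and "ahlfors_regular X d Q"
    and "0 < \<delta>" and "\<delta> < 1"
  shows "ahlfors_regular X (snowflake d \<delta>) (Q / \<delta>)
    \<and> (\<exists>l::real. 0 < l \<and> l < 1 \<and>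
          (\<forall>p\<in>X. \<forall>r>0. ennreal r < diam_wrt (snowflake d \<delta>) X \<longrightarrow>
            (\<exists>q1\<in>Metric_space.mball X (snowflake d \<delta>) p r.
             \<exists>q2\<in>Metric_space.mball X (snowflake d \<delta>) p r.
               snowflake d \<delta> q1 q2 \<ge> l * r \<and>
               (\<forall>p1\<in>X - Metric_space.mball X (snowflake d \<delta>) p r.
                \<forall>p2\<in>X - Metric_space.mball X (snowflake d \<delta>) p r.
                  snowflake d \<delta> p1 p2 \<le> snowflake d \<delta> p1 q1 + snowflake d \<delta> p2 q2))))
    \<and> (\<exists>d' :: 'a \<Rightarrow> 'a \<Rightarrow> real.
          Metric_space X d' \<and>
          (\<forall>p\<in>X. \<forall>q\<in>X. d' p q \<le> snowflake d \<delta> p q) \<and>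
          ahlfors_regular X d' (Q / \<delta>) \<and>
          (\<forall>A\<subseteq>X. separable_space (subtopology (Metric_space.mtopology X d) A) \<longrightarrow>
             hausdorff_measure X (snowflake d \<delta>) (Q / \<delta>) A > 0 \<longrightarrow>
             \<not> bilipschitz_equivalent_on A d' (snowflake d \<delta>)))"
  using ahlfors_regular_snowflake[OF assms(3-5)] snowflake_ball_condition[OF assms(3,2,4,5)]
    ex_shortcut_distance[OF assms(3,2,4,5)]
  by blast

end
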